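(* Let $X$ be a separable infinite-dimensional complex Banach space and let $T\in\mathcal{L}(X)$ with $\Omega(T)\neq\emptyset$. Suppose there exist an infinite-dimensional closed subspace $E\subset X$ and a strictly increasing sequence of positive integers $(\psi_n)_n$ such that $\sup_n\|T^{\psi_n}|_E\|<\infty$. Then, for every countable collection $\{g_i\}_{i\in\mathbb{N}}\subset\Omega(T)$ simultaneously approximated by $T$, there exist a strictly increasing sequence $(\theta_n)_n$ of positive integers and infinite-dimensional closed subspaces $\{M_i\}_{i\in\mathbb{N}}$ of $X$ such that $$\lim_{n\to\infty}T^{\theta_n}x=g_i(x)\quad\text{for all }x\in M_i\text{ and all }i\in\mathbb{N}.$$
   Context: $\mathcal{L}(X)$ is the space of continuous linear operators on $X$. $\Omega(T)$ is the set of all $h\in\mathcal{L}(X)$ for which there is a strictly increasing sequence of positive integers $(\omega_n)_n$ such that $\{x\in X:T^{\omega_n}x\to h(x)\}$ is dense in $X$. For a continuous linear operator $S$ on a Banach space $Y$, $\Sigma(S)$ is the set of $h\in\mathcal{L}(Y)$ such that the set of $y\in Y$ for which there is a strictly increasing sequence of positive integers $(\omega_n)_n$ with $S^{\omega_n}y\to h(y)$ is dense in $Y$. A collection $\{h_\ell\}_{\ell\in J}\subset\mathcal{L}(X)$ is simultaneously approximated by $T$ if for every $n\in\mathbb{N}$ and all members $f_1,\dots,f_n$ of the collection (repetitions allowed), the coordinatewise map $(f_1,\dots,f_n):X^n\to X^n$ belongs to $\Sigma\left(\bigoplus_{i=1}^nT\right)$, where $\bigoplus_{i=1}^nT$ acts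 coordinatewise on $X^n$. *)

theory Defs
  imports "HOL-Analysis.Analysis"
begin

class complex_banach = banach +
  fixes scaleC :: "complex \<Rightarrow> 'a \<Rightarrow> 'a"  (infixr "*\<^sub>C" 75)
  assumes scaleC_add_right: "c *\<^sub>C (x + y) = c *\<^sub>C x + c *\<^sub>C y"
    and scaleC_add_left: "(c + d) *\<^sub>C x = c *\<^sub>C x + d *\<^sub>C x"
    and scaleC_scaleC: "c *\<^sub>C d *\<^sub>C x = (c * d) *\<^sub>C x"
    and scaleC_of_real: "complex_of_real r *\<^sub>C x = r *\<^sub>R x"
    and norm_scaleC: "norm (c *\<^sub>C x) = cmod c * norm x"

global_interpretation complex_vector: vector_space "scaleC :: complex \<Rightarrow> 'a \<Rightarrow> 'a::complex_banach"
  defines csubspace = complex_vector.subspace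
    and cspan = complex_vector.span
proof unfold_locales
  fix x :: 'a
  show "1 *\<^sub>C x = x"
    using scaleC_of_real[of 1 x] by simp
qed (simp_all add: scaleC_add_right scaleC_add_left scaleC_scaleC)

definition infinite_dimensional :: "'a::complex_banach set \<Rightarrow> bool" where
  "infinite_dimensional V \<longleftrightarrow> \<not> (\<exists>B. finite B \<and> V \<subseteq> cspan B)"

definition inf_dim_closed_subspace :: "'a::complex_banach set \<Rightarrow> bool" where
  "inf_dim_closed_subspace V \<longleftrightarrow> csubspace V \<and> closed V \<and> infinite_dimensional V"

definition cont_lin_ops :: "('a::complex_banach \<Rightarrow> 'a) set" where
  "cont_lin_ops = {h. Vector_Spaces.linear scaleC scaleC h \<and> continuous_on UNIV h}"

definition pos_strict_seq :: "(nat \<Rightarrow> nat) \<Rightarrow> bool" where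
  "pos_strict_seq \<omega> \<longleftrightarrow> strict_mono \<omega> \<and> (\<forall>n. 0 < \<omega> n)"

(* Operator norm of the restriction of f to the subspace E, following the library's onorm:
   the vector 0 contributes the value 0 / 0 = 0. *)
definition onorm_on :: "'a::real_normed_vector set \<Rightarrow> ('a \<Rightarrow> 'a) \<Rightarrow> real" where
  "onorm_on E f = (SUP x\<in>E. norm (f x) / norm x)"

definition Omega_set :: "('a::complex_banach \<Rightarrow> 'a) \<Rightarrow> ('a \<Rightarrow> 'a) set" where
  "Omega_set T = {h \<in> cont_lin_ops. \<exists>\<omega>. pos_strict_seq \<omega> \<and>
     closure {x. (\<lambda>n. (T ^^ \<omega> n) x) \<longlonglongrightarrow> h x} = UNIV}"

(* The finite powers of a Banach space have no type of their own when the exponent varies, so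
   operators on them, and the set Sigma, are formulated for a carrier topspace Y with explicit
   addition and scalar multiplication. *)
definition cont_lin_ops_on ::
  "'y topology \<Rightarrow> ('y \<Rightarrow> 'y \<Rightarrow> 'y) \<Rightarrow> (complex \<Rightarrow> 'y \<Rightarrow> 'y) \<Rightarrow> ('y \<Rightarrow> 'y) set" where
  "cont_lin_ops_on Y add scl = {h. continuous_map Y Y h \<and>
     (\<forall>x\<in>topspace Y. \<forall>y\<in>topspace Y. h (add x y) = add (h x) (h y)) \<and>
     (\<forall>c. \<forall>x\<in>topspace Y. h (scl c x) = scl c (h x))}"

lemma cont_lin_ops_on_euclidean:
  "cont_lin_ops_on euclidean (+) scaleC = (cont_lin_ops :: ('a::complex_banach \<Rightarrow> 'a) set)"
proof -
  have "Vector_Spaces.linear scaleC scaleC h \<longleftrightarrow>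
      (\<forall>x y. h (x + y) = h x + h y) \<and> (\<forall>c x. h (c *\<^sub>C x) = c *\<^sub>C h x)" for h :: "'a \<Rightarrow> 'a"
    by (auto simp: Vector_Spaces.linear_iff complex_vector.vector_space_axioms)
  then show ?thesis
    by (auto simp: cont_lin_ops_on_def cont_lin_ops_def)
qed

definition Sigma_set ::
  "'y topology \<Rightarrow> ('y \<Rightarrow> 'y \<Rightarrow> 'y) \<Rightarrow> (complex \<Rightarrow> 'y \<Rightarrow> 'y) \<Rightarrow> ('y \<Rightarrow> 'y) \<Rightarrow> ('y \<Rightarrow> 'y) set" where
  "Sigma_set Y add scl S = {h \<in> cont_lin_ops_on Y add scl.
     Y closure_of {y \<in> topspace Y. \<exists>\<omega>. pos_strict_seq \<omega> \<and>
       limitin Y (\<lambda>k. (S ^^ \<omega> k) y) (h y) sequentially} = topspace Y}"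

(* The n-th power of X consists of the functions on {..<n}, extended by undefined. Every
   product norm induces the product topology, and Sigma depends on the norm only through it. *)
definition power_top :: "nat \<Rightarrow> (nat \<Rightarrow> 'a::complex_banach) topology" where
  "power_top n = product_topology (\<lambda>_. euclidean) {..<n}"

definition power_add ::
  "nat \<Rightarrow> (nat \<Rightarrow> 'a::complex_banach) \<Rightarrow> (nat \<Rightarrow> 'a) \<Rightarrow> (nat \<Rightarrow> 'a)" where
  "power_add n x y = (\<lambda>i\<in>{..<n}. x i + y i)"

definition power_scale ::
  "nat \<Rightarrow> complex \<Rightarrow> (nat \<Rightarrow> 'a::complex_banach) \<Rightarrow> (nat \<Rightarrow> 'a)" where
  "power_scale n c x = (\<lambda>i\<in>{..<n}. c *\<^sub>C x i)"

definition coordinatewise ::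
  "nat \<Rightarrow> (nat \<Rightarrow> 'a \<Rightarrow> 'a) \<Rightarrow> (nat \<Rightarrow> 'a) \<Rightarrow> (nat \<Rightarrow> 'a)" where
  "coordinatewise n f x = (\<lambda>i\<in>{..<n}. f i (x i))"

definition simultaneously_approximated ::
  "('a::complex_banach \<Rightarrow> 'a) set \<Rightarrow> ('a \<Rightarrow> 'a) \<Rightarrow> bool" where
  "simultaneously_approximated H T \<longleftrightarrow>
     (\<forall>n\<ge>1. \<forall>f. (\<forall>i<n. f i \<in> H) \<longrightarrow>
        coordinatewise n f \<in>
          Sigma_set (power_top n) (power_add n) (power_scale n) (coordinatewise n (\<lambda>_. T)))"

end

theory Submission
  imports Defs
begin

text \<open>
Two facts carry the proof. The bounded powers on \<open>E\<close> produce a complex number \<open>\<mu>\<close> with \<open>\<bar>\<mu>\<bar> \<le> 1\<close>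
such that \<open>T - \<mu>\<close> is not bounded below on any subspace of finite codimension, and near the
corresponding almost eigenvectors every power of \<open>T\<close>, along whatever sequence, stays bounded on
suitable tails. This decouples the sequence \<open>\<psi>\<close> from the sequences that come with the
approximation hypothesis.

\<^bold>\<open>The number \<open>\<mu>\<close>.\<close> Suppose that for every \<open>a\<close> in the closed unit disc \<open>T - a\<close> is bounded below on
a subspace of finite codimension. By compactness the lower bound \<open>c\<close> can be chosen uniformly on a
slightly larger disc. Averaging \<open>(T - a)\<^sup>-\<^sup>1\<close> over the points \<open>a\<close> of a circle of radius \<open>r\<close> whose
\<open>N\<close>-th power is \<open>r\<^sup>N\<close> gives \<open>T\<^sup>N\<^sup>-\<^sup>1 (T\<^sup>N - r\<^sup>N)\<^sup>-\<^sup>1\<close>, and the resolvents at two nearby radii differ little,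
uniformly in \<open>N\<close>. This is Rickart's proof of the spectral radius formula; written with polynomials
in \<open>T\<close> instead of inverses, it only uses lower bounds (\<open>power_resolvent_bound\<close>). It shows that if
some \<open>T\<^sup>N\<close> is bounded below by \<open>r\<^sup>N\<close>, essentially, then the same holds for a radius larger by a
fixed amount (\<open>power_bounded_below_step\<close>). So some radius \<open>r > 1\<close> is reached, and the powers of
\<open>T\<close> are unbounded along every sequence on every infinite-dimensional subspace; this contradicts the
choice of \<open>E\<close> (\<open>shift_not_bounded_below\<close>).

\<^bold>\<open>The subspaces.\<close> Mazur's construction gives a normalized basic sequence \<open>e\<close> with \<open>(T - \<mu>) e\<^sub>n \<rightarrow> 0\<close>
(\<open>basic_sequence_exists\<close>). An induction picks times \<open>\<theta>\<^sub>n\<close>, a subsequence of \<open>e\<close>, and small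
perturbations: at stage \<open>n\<close> a new vector \<open>e\<^sub>k\<close>, almost an eigenvector for all powers up to
\<open>\<theta>\<^sub>n\<^sub>-\<^sub>1\<close>, is adjoined, and then all vectors found so far are moved a little to a tuple on which
some power \<open>\<theta>\<^sub>n > \<theta>\<^sub>n\<^sub>-\<^sub>1\<close> of \<open>T\<close> is close to the prescribed operators. The old vectors cannot be
kept fixed, since the approximable tuples are dense but form no product. The limits \<open>z\<^sub>j\<close> form a
perturbation of a basic sequence (\<open>perturbed_basic_sequence\<close>).

The indices \<open>j\<close> are split into infinitely many infinite classes, one for each \<open>g\<^sub>i\<close>, and \<open>M\<^sub>i\<close> is
the closed span of the \<open>z\<^sub>j\<close> in the \<open>i\<close>-th class. On the span of the class, \<open>T\<close> to the power \<open>\<theta>\<^sub>n\<close>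
acts almost as \<open>g\<^sub>i\<close> on the coordinates \<open>j \<le> n\<close> and almost as a multiple of modulus at most \<open>1\<close> on
the coordinates \<open>j > n\<close>, so these powers are uniformly bounded there (\<open>power_bound_on_span\<close>).
Convergence on the vectors \<open>z\<^sub>j\<close> then extends to the closure.
\<close>

section \<open>Complex-linear operators\<close>

lemma bounded_bilinear_scaleC:
  "bounded_bilinear (scaleC :: complex \<Rightarrow> 'a \<Rightarrow> 'a::complex_banach)"
proof
  fix a a' :: complex and b b' :: 'a and r :: real
  show "(a + a') *\<^sub>C b = a *\<^sub>C b + a' *\<^sub>C b" by (rule scaleC_add_left)
  show "a *\<^sub>C (b + b') = a *\<^sub>C b + a *\<^sub>C b'" by (rule scaleC_add_right)
  show "(r *\<^sub>R a) *\<^sub>C b = r *\<^sub>R (a *\<^sub>C b)"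
    by (simp add: scaleC_of_real[symmetric] scaleC_scaleC scaleR_conv_of_real)
  show "a *\<^sub>C (r *\<^sub>R b) = r *\<^sub>R (a *\<^sub>C b)"
    by (simp add: scaleC_of_real[symmetric] scaleC_scaleC mult.commute)
  show "\<exists>K. \<forall>(a::complex) (b::'a). norm (a *\<^sub>C b) \<le> norm a * norm b * K"
    by (intro exI[of _ 1]) (simp add: norm_scaleC)
qed

interpretation scaleC: bounded_bilinear
  "scaleC :: complex \<Rightarrow> 'a \<Rightarrow> 'a::complex_banach"
  by (rule bounded_bilinear_scaleC)

abbreviation clinear :: "('a::complex_banach \<Rightarrow> 'a) \<Rightarrow> bool" where
  "clinear \<equiv> Vector_Spaces.linear scaleC scaleC"

lemma clinear_iff:
  "clinear f \<longleftrightarrow> (\<forall>x y. f (x + y) = f x + f y) \<and> (\<forall>c x. f (c *\<^sub>C x) = c *\<^sub>C f x)"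
  by (auto simp: Vector_Spaces.linear_iff complex_vector.vector_space_axioms)

lemma clinear_add: "clinear f \<Longrightarrow> f (x + y) = f x + f y"
  and clinear_scale: "clinear f \<Longrightarrow> f (c *\<^sub>C x) = c *\<^sub>C f x"
  by (auto simp: clinear_iff)

lemma clinear_scaleR: "clinear f \<Longrightarrow> f (r *\<^sub>R x) = r *\<^sub>R f x"
  by (metis clinear_scale scaleC_of_real)

lemma clinear_imp_linear: "clinear f \<Longrightarrow> linear f"
  by (intro linearI) (simp_all add: clinear_add clinear_scaleR)

lemma clinear_zero: "clinear f \<Longrightarrow> f 0 = 0"
  and clinear_diff: "clinear f \<Longrightarrow> f (x - y) = f x - f y"
  and clinear_sum: "clinear f \<Longrightarrow> f (sum h A) = (\<Sum>i\<in>A. f (h i))"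
  using clinear_imp_linear linear_0 linear_diff linear_sum by blast+

lemma clinear_funpow: "clinear f \<Longrightarrow> clinear (f ^^ n)"
  by (induction n) (simp_all add: clinear_iff)

lemma clinear_compose: "clinear f \<Longrightarrow> clinear g \<Longrightarrow> clinear (\<lambda>x. f (g x))"
  and clinear_minus: "clinear f \<Longrightarrow> clinear g \<Longrightarrow> clinear (\<lambda>x. f x - g x)"
  and clinear_scaled: "clinear f \<Longrightarrow> clinear (\<lambda>x. c *\<^sub>C f x)"
  and clinear_id: "clinear (\<lambda>x. x)"
  by (simp_all add: clinear_iff scaleC.diff_right scaleC.add_right scaleC_scaleC mult.commute)

lemma clinear_sum_fun: "(\<And>i. i \<in> A \<Longrightarrow> clinear (f i)) \<Longrightarrow> clinear (\<lambda>x. \<Sum>i\<in>A. f i x)"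
  by (simp add: clinear_iff sum.distrib scaleC.sum_right)

lemma cont_lin_ops_clinear: "T \<in> cont_lin_ops \<Longrightarrow> clinear T"
  by (simp add: cont_lin_ops_def)

lemma cont_lin_ops_bounded:
  assumes "T \<in> cont_lin_ops"
  obtains L where "L \<ge> 1" "\<And>x. norm (T x) \<le> L * norm x"
proof -
  have lin: "clinear T" and cont: "continuous_on UNIV T"
    using assms by (auto simp: cont_lin_ops_def)
  then have "(T \<longlongrightarrow> T 0) (at 0)"
    by (simp add: continuous_on_eq_continuous_at isCont_def)
  then obtain d where d: "d > 0" "\<And>x. norm x < d \<Longrightarrow> norm (T x) < 1"
    using tendstoD[of T "T 0" "at 0" 1] clinear_zero[OF lin]
    by (auto simp: eventually_at) (metis norm_zero zero_less_one)
  have "norm (T x) \<le> (2 / d) * norm x" for x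
  proof (cases "x = 0")
    case False
    then have "norm ((d / (2 * norm x)) *\<^sub>R x) < d"
      using d(1) by simp
    then have "norm (T ((d / (2 * norm x)) *\<^sub>R x)) < 1"
      by (rule d(2))
    then have "d / (2 * norm x) * norm (T x) < 1"
      using d(1) by (simp add: clinear_scaleR[OF lin])
    then show ?thesis
      using d(1) False by (simp add: field_simps)
  qed (simp add: clinear_zero[OF lin])
  then have "norm (T x) \<le> max 1 (2 / d) * norm x" for x
    by (meson max.cobounded2 mult_right_mono norm_ge_zero order_trans)
  then show ?thesis
    by (rule that[rotated]) simp
qed

lemma norm_funpow_le:
  fixes T :: "'a::real_normed_vector \<Rightarrow> 'a"
  assumes "\<And>x. norm (T x) \<le> L * norm x" "L \<ge> 0"
  shows "norm ((T ^^ n) x) \<le> L ^ n * norm x"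
proof (induction n)
  case (Suc n)
  have "norm ((T ^^ Suc n) x) \<le> L * norm ((T ^^ n) x)"
    using assms(1)[of "(T ^^ n) x"] by simp
  also have "\<dots> \<le> L * (L ^ n * norm x)"
    by (intro mult_left_mono Suc assms)
  finally show ?case by simp
qed simp

section \<open>The filter of subspaces of finite codimension\<close>

text \<open>Complex-linear functionals. Continuity is not required: the subspaces of finite codimension
  below need not be closed.\<close>

definition cfunctional :: "('a::complex_banach \<Rightarrow> complex) \<Rightarrow> bool" where
  "cfunctional \<phi> \<longleftrightarrow> (\<forall>x y. \<phi> (x + y) = \<phi> x + \<phi> y) \<and> (\<forall>c x. \<phi> (c *\<^sub>C x) = c * \<phi> x)"

text \<open>The filter generated by the subspaces of finite codimension, that is, by the common kernels of
  finitely many functionals. A property holds eventually if it holds on one such subspace.\<close>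

definition cofin :: "'a::complex_banach filter" where
  "cofin = (INF \<Phi>\<in>{\<Phi>. finite \<Phi> \<and> (\<forall>\<phi>\<in>\<Phi>. cfunctional \<phi>)}. principal {x. \<forall>\<phi>\<in>\<Phi>. \<phi> x = 0})"

lemma eventually_cofin:
  "eventually P cofin \<longleftrightarrow>
     (\<exists>\<Phi>. finite \<Phi> \<and> (\<forall>\<phi>\<in>\<Phi>. cfunctional \<phi>) \<and> (\<forall>x. (\<forall>\<phi>\<in>\<Phi>. \<phi> x = 0) \<longrightarrow> P x))"
proof -
  have "eventually P cofin \<longleftrightarrow> (\<exists>\<Phi>\<in>{\<Phi>. finite \<Phi> \<and> (\<forall>\<phi>\<in>\<Phi>. cfunctional \<phi>)}.
      eventually P (principal {x. \<forall>\<phi>\<in>\<Phi>. \<phi> x = 0}))"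
    unfolding cofin_def
  proof (rule eventually_INF_base)
    fix a b :: "('a \<Rightarrow> complex) set"
    assume "a \<in> {\<Phi>. finite \<Phi> \<and> (\<forall>\<phi>\<in>\<Phi>. cfunctional \<phi>)}"
      and "b \<in> {\<Phi>. finite \<Phi> \<and> (\<forall>\<phi>\<in>\<Phi>. cfunctional \<phi>)}"
    then show "\<exists>\<Phi>\<in>{\<Phi>. finite \<Phi> \<and> (\<forall>\<phi>\<in>\<Phi>. cfunctional \<phi>)}.
        principal {x. \<forall>\<phi>\<in>\<Phi>. \<phi> x = 0}
          \<le> inf (principal {x. \<forall>\<phi>\<in>a. \<phi> x = 0}) (principal {x. \<forall>\<phi>\<in>b. \<phi> x = 0})"
      by (intro bexI[of _ "a \<union> b"]) auto
  qed auto
  then show ?thesis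
    by (auto simp: eventually_principal)
qed

text \<open>Preimages of subspaces of finite codimension under linear maps have finite codimension. Hence
  an inequality that holds eventually may be applied to any polynomial in an operator.\<close>

lemma eventually_cofin_clinear:
  assumes "eventually P cofin" "clinear f"
  shows "eventually (\<lambda>x. P (f x)) cofin"
proof -
  obtain \<Phi> where "finite \<Phi>" "\<forall>\<phi>\<in>\<Phi>. cfunctional \<phi>" "\<forall>x. (\<forall>\<phi>\<in>\<Phi>. \<phi> x = 0) \<longrightarrow> P x"
    using assms(1) by (auto simp: eventually_cofin)
  moreover have "cfunctional (\<lambda>x. \<phi> (f x))" if "cfunctional \<phi>" for \<phi>
    using that assms(2) by (auto simp: cfunctional_def clinear_iff)
  ultimately show ?thesis
    unfolding eventually_cofin by (intro exI[of _ "(\<lambda>\<phi> x. \<phi> (f x)) ` \<Phi>"]) auto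
qed

lemma eventually_cofin_scale:
  assumes "eventually P cofin"
  shows "eventually (\<lambda>x. \<forall>c. P (c *\<^sub>C x)) cofin"
proof -
  obtain \<Phi> where "finite \<Phi>" "\<forall>\<phi>\<in>\<Phi>. cfunctional \<phi>" "\<forall>x. (\<forall>\<phi>\<in>\<Phi>. \<phi> x = 0) \<longrightarrow> P x"
    using assms by (auto simp: eventually_cofin)
  moreover have "\<phi> (c *\<^sub>C x) = 0" if "cfunctional \<phi>" "\<phi> x = 0" for \<phi> c x
    using that by (simp add: cfunctional_def)
  ultimately show ?thesis
    unfolding eventually_cofin by (intro exI[of _ \<Phi>]) blast
qed

lemma infinite_dimensional_Int_kernel:
  assumes "csubspace E" "infinite_dimensional E" "cfunctional \<phi>"
  shows "csubspace (E \<inter> {x. \<phi> x = 0}) \<and> infinite_dimensional (E \<inter> {x. \<phi> x = 0})"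
proof
  have \<phi>: "\<phi> (x + y) = \<phi> x + \<phi> y" "\<phi> (c *\<^sub>C x) = c * \<phi> x" for x y c
    using assms(3) by (auto simp: cfunctional_def)
  have \<phi>0: "\<phi> 0 = 0" using \<phi>(2)[of 0 0] by simp
  have \<phi>d: "\<phi> (x - y) = \<phi> x - \<phi> y" for x y
    using \<phi>(1)[of "x - y" y] by simp
  show "csubspace (E \<inter> {x. \<phi> x = 0})"
    using assms(1) \<phi> \<phi>0 by (auto simp: complex_vector.subspace_def)
  show "infinite_dimensional (E \<inter> {x. \<phi> x = 0})"
    unfolding infinite_dimensional_def
  proof
    assume "\<exists>B. finite B \<and> E \<inter> {x. \<phi> x = 0} \<subseteq> cspan B"
    then obtain B where B: "finite B" "E \<inter> {x. \<phi> x = 0} \<subseteq> cspan B" by blast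
    show False
    proof (cases "\<exists>v\<in>E. \<phi> v \<noteq> 0")
      case True
      then obtain v where v: "v \<in> E" "\<phi> v \<noteq> 0" by blast
      have "E \<subseteq> cspan (insert v B)"
      proof
        fix x assume x: "x \<in> E"
        have "x - (\<phi> x / \<phi> v) *\<^sub>C v \<in> E \<inter> {x. \<phi> x = 0}"
          using x v assms(1) by (auto simp: \<phi>d \<phi> complex_vector.subspace_diff complex_vector.subspace_scale)
        then have "x - (\<phi> x / \<phi> v) *\<^sub>C v \<in> cspan B" using B by blast
        then show "x \<in> cspan (insert v B)"
          by (auto simp: complex_vector.span_insert)
      qed
      then show False
        using assms(2) B(1) unfolding infinite_dimensional_def by (metis finite_insert)
    next
      case False
      then have "E \<subseteq> cspan B" using B by blast
      then show False
        using assms(2) B(1) unfolding infinite_dimensional_def by blast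
    qed
  qed
qed

lemma eventually_cofin_meets:
  assumes "csubspace E" "infinite_dimensional E" "eventually P cofin"
  shows "\<exists>y\<in>E. y \<noteq> 0 \<and> P y"
proof -
  obtain \<Phi> where \<Phi>: "finite \<Phi>" "\<forall>\<phi>\<in>\<Phi>. cfunctional \<phi>" "\<forall>x. (\<forall>\<phi>\<in>\<Phi>. \<phi> x = 0) \<longrightarrow> P x"
    using assms(3) by (auto simp: eventually_cofin)
  have "csubspace (E \<inter> {x. \<forall>\<phi>\<in>\<Phi>. \<phi> x = 0}) \<and> infinite_dimensional (E \<inter> {x. \<forall>\<phi>\<in>\<Phi>. \<phi> x = 0})"
    using \<Phi>(1,2)
  proof (induction \<Phi>)
    case empty
    then show ?case using assms by simp
  next
    case (insert \<phi> \<Phi>)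
    have "E \<inter> {x. \<forall>\<phi>\<in>insert \<phi> \<Phi>. \<phi> x = 0} = (E \<inter> {x. \<forall>\<phi>\<in>\<Phi>. \<phi> x = 0}) \<inter> {x. \<phi> x = 0}"
      by auto
    moreover have "cfunctional \<phi>" using insert.prems by simp
    moreover note insert.IH
    ultimately show ?case
      using insert.prems by (simp add: infinite_dimensional_Int_kernel)
  qed
  then have "\<not> E \<inter> {x. \<forall>\<phi>\<in>\<Phi>. \<phi> x = 0} \<subseteq> cspan {}"
    unfolding infinite_dimensional_def by blast
  then show ?thesis
    using \<Phi>(3) by auto
qed

section \<open>Norming functionals\<close>

text \<open>A minimal sublinear functional is linear, so Zorn's lemma gives the Hahn-Banach theorem in the
  form needed here. Sublinear means subadditive and positively homogeneous. The
  construction \<open>lower_at\<close> is used twice: at the norm, to force the value at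
  the given vector, and at a minimal functional, to see that it is additive.\<close>

definition sublinear :: "('a::real_vector \<Rightarrow> real) \<Rightarrow> bool" where
  "sublinear p \<longleftrightarrow> (\<forall>x y. p (x + y) \<le> p x + p y) \<and> (\<forall>t\<ge>0. \<forall>x. p (t *\<^sub>R x) = t * p x)"

lemma sublinearD:
  assumes "sublinear p"
  shows "p (x + y) \<le> p x + p y" "t \<ge> 0 \<Longrightarrow> p (t *\<^sub>R x) = t * p x" "p 0 = 0" "- p (- x) \<le> p x"
proof -
  show 1: "p (x + y) \<le> p x + p y" "t \<ge> 0 \<Longrightarrow> p (t *\<^sub>R x) = t * p x" for x y t
    using assms by (auto simp: sublinear_def)
  show 2: "p 0 = 0" using 1(2)[of 0 0] by simp
  show "- p (- x) \<le> p x" using 1(1)[of x "-x"] 2 by simp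
qed

text \<open>For sublinear \<open>p\<close>, the largest sublinear functional \<open>q \<le> p\<close> with \<open>q (- y) \<le> - p y\<close>.\<close>

definition lower_at :: "('a::real_vector \<Rightarrow> real) \<Rightarrow> 'a \<Rightarrow> 'a \<Rightarrow> real" where
  "lower_at p y x = (INF t\<in>{0..}. p (x + t *\<^sub>R y) - t * p y)"

lemma lower_at:
  assumes "sublinear p"
  shows "sublinear (lower_at p y)" "lower_at p y x \<le> p x" "lower_at p y (- y) \<le> - p y"
proof -
  note p = sublinearD[OF assms]
  have bdd: "bdd_below ((\<lambda>t. p (x + t *\<^sub>R y) - t * p y) ` {0..})" for x
  proof (rule bdd_belowI2)
    fix t :: real assume "t \<in> {0..}"
    then have "t * p y = p (t *\<^sub>R y)" by (simp add: p)
    also have "\<dots> \<le> p (x + t *\<^sub>R y) + p (- x)"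
      using p(1)[of "x + t *\<^sub>R y" "- x"] by (simp add: algebra_simps)
    finally show "- p (- x) \<le> p (x + t *\<^sub>R y) - t * p y" by simp
  qed
  have le: "lower_at p y x \<le> p (x + t *\<^sub>R y) - t * p y" if "t \<ge> 0" for t x
    unfolding lower_at_def using that by (intro cINF_lower bdd) auto
  have ge: "c \<le> lower_at p y x" if "\<And>t. t \<ge> 0 \<Longrightarrow> c \<le> p (x + t *\<^sub>R y) - t * p y" for c x
    unfolding lower_at_def using that by (intro cINF_greatest) auto
  show "lower_at p y x \<le> p x" using le[of 0 x] by simp
  show "lower_at p y (- y) \<le> - p y" using le[of 1 "- y"] by (simp add: p)
  show "sublinear (lower_at p y)"
    unfolding sublinear_def
  proof (intro conjI allI impI)
    fix x z
    have *: "lower_at p y (x + z) \<le> p (x + s *\<^sub>R y) - s * p y + (p (z + t *\<^sub>R y) - t * p y)"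
      if "s \<ge> 0" "t \<ge> 0" for s t
    proof -
      have "lower_at p y (x + z) \<le> p (x + z + (s + t) *\<^sub>R y) - (s + t) * p y"
        using that by (intro le) simp
      also have "x + z + (s + t) *\<^sub>R y = (x + s *\<^sub>R y) + (z + t *\<^sub>R y)"
        by (simp add: algebra_simps)
      also have "p \<dots> - (s + t) * p y \<le> p (x + s *\<^sub>R y) - s * p y + (p (z + t *\<^sub>R y) - t * p y)"
        using p(1)[of "x + s *\<^sub>R y" "z + t *\<^sub>R y"] by (simp add: algebra_simps)
      finally show ?thesis .
    qed
    have "lower_at p y (x + z) - (p (x + s *\<^sub>R y) - s * p y) \<le> lower_at p y z" if "s \<ge> 0" for s
      using *[OF that] by (intro ge) (simp add: algebra_simps)
    then have "lower_at p y (x + z) - lower_at p y z \<le> lower_at p y x"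
      by (intro ge) (simp add: algebra_simps)
    then show "lower_at p y (x + z) \<le> lower_at p y x + lower_at p y z" by simp
  next
    fix t :: real and x assume t: "t \<ge> 0"
    show "lower_at p y (t *\<^sub>R x) = t * lower_at p y x"
    proof (cases "t = 0")
      case True
      have "lower_at p y 0 \<le> 0"
        using le[of 0 0] by (simp add: p)
      moreover have "0 \<le> lower_at p y 0"
        by (intro ge) (simp add: p)
      ultimately show ?thesis using True by simp
    next
      case False
      with t have t: "t > 0" by simp
      have scale: "p (t *\<^sub>R x + s *\<^sub>R y) - s * p y = t * (p (x + (s / t) *\<^sub>R y) - s / t * p y)" for s x
        using t p(2)[of t "x + (s / t) *\<^sub>R y"] by (simp add: scaleR_right_distrib right_diff_distrib)
      show ?thesis
      proof (rule antisym)
        have "lower_at p y (t *\<^sub>R x) / t \<le> lower_at p y x"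
        proof (rule ge)
          fix s :: real assume "s \<ge> 0"
          then have "lower_at p y (t *\<^sub>R x) \<le> p (t *\<^sub>R x + (t * s) *\<^sub>R y) - (t * s) * p y"
            using t by (intro le) simp
          then show "lower_at p y (t *\<^sub>R x) / t \<le> p (x + s *\<^sub>R y) - s * p y"
            unfolding scale using t by (simp add: field_simps)
        qed
        then show "lower_at p y (t *\<^sub>R x) \<le> t * lower_at p y x"
          using t by (simp add: field_simps)
      next
        show "t * lower_at p y x \<le> lower_at p y (t *\<^sub>R x)"
        proof (rule ge)
          fix s :: real assume "s \<ge> 0"
          then have "lower_at p y x \<le> p (x + (s / t) *\<^sub>R y) - (s / t) * p y"
            using t by (intro le) simp
          then show "t * lower_at p y x \<le> p (t *\<^sub>R x + s *\<^sub>R y) - s * p y"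
            unfolding scale using t by (intro mult_left_mono) auto
        qed
      qed
    qed
  qed
qed

lemma sublinear_Inf_chain:
  assumes ne: "C \<noteq> {}" and sub: "\<And>q. q \<in> C \<Longrightarrow> sublinear q"
    and chain: "\<And>q r. q \<in> C \<Longrightarrow> r \<in> C \<Longrightarrow> q \<le> r \<or> r \<le> q"
    and below: "\<And>q. q \<in> C \<Longrightarrow> q \<le> p"
  shows "sublinear (\<lambda>x. INF q\<in>C. q x)" "q \<in> C \<Longrightarrow> (INF q\<in>C. q x) \<le> q x"
proof -
  have bdd: "bdd_below ((\<lambda>q. q x) ` C)" for x
  proof (rule bdd_belowI2)
    fix q assume "q \<in> C"
    then show "- p (- x) \<le> q x"
      using sublinearD(4)[OF sub, of q x] le_funD[OF below, of q "- x"] by linarith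
  qed
  have le: "(INF q\<in>C. q x) \<le> q x" if "q \<in> C" for q x
    using that by (intro cINF_lower bdd)
  have ge: "c \<le> (INF q\<in>C. q x)" if "\<And>q. q \<in> C \<Longrightarrow> c \<le> q x" for c x
    using that ne by (intro cINF_greatest)
  show "q \<in> C \<Longrightarrow> (INF q\<in>C. q x) \<le> q x" by (rule le)
  show "sublinear (\<lambda>x. INF q\<in>C. q x)"
    unfolding sublinear_def
  proof (intro conjI allI impI)
    fix x z
    have *: "(INF q\<in>C. q (x + z)) \<le> q x + r z" if "q \<in> C" "r \<in> C" for q r
    proof -
      consider "q \<le> r" | "r \<le> q" using chain \<open>q \<in> C\<close> \<open>r \<in> C\<close> by blast
      then show ?thesis
      proof cases
        case 1
        have "(INF q\<in>C. q (x + z)) \<le> q (x + z)" using that by (intro le)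
        also have "\<dots> \<le> q x + q z" using sublinearD(1) sub that by blast
        also have "\<dots> \<le> q x + r z" using 1 by (simp add: le_fun_def)
        finally show ?thesis .
      next
        case 2
        have "(INF q\<in>C. q (x + z)) \<le> r (x + z)" using that by (intro le)
        also have "\<dots> \<le> r x + r z" using sublinearD(1) sub that by blast
        also have "\<dots> \<le> q x + r z" using 2 by (simp add: le_fun_def)
        finally show ?thesis .
      qed
    qed
    have "(INF q\<in>C. q (x + z)) - q x \<le> (INF q\<in>C. q z)" if "q \<in> C" for q
      using *[OF that] by (intro ge) (simp add: algebra_simps)
    then have "(INF q\<in>C. q (x + z)) - (INF q\<in>C. q z) \<le> (INF q\<in>C. q x)"
      by (intro ge) (simp add: algebra_simps)
    then show "(INF q\<in>C. q (x + z)) \<le> (INF q\<in>C. q x) + (INF q\<in>C. q z)" by simp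
  next
    fix t :: real and x assume t: "t \<ge> 0"
    have eq: "q (t *\<^sub>R x) = t * q x" if "q \<in> C" for q
      using sublinearD(2)[OF sub] that t by blast
    show "(INF q\<in>C. q (t *\<^sub>R x)) = t * (INF q\<in>C. q x)"
    proof (cases "t = 0")
      case True
      have "(INF q\<in>C. q 0) = (INF q\<in>C. 0::real)"
        by (intro INF_cong refl sublinearD(3) sub)
      then have "(INF q\<in>C. q 0) = 0"
        using ne by simp
      then show ?thesis using True by simp
    next
      case False
      with t have t: "t > 0" by simp
      show ?thesis
      proof (rule antisym)
        have "(INF q\<in>C. q (t *\<^sub>R x)) / t \<le> (INF q\<in>C. q x)"
        proof (rule ge)
          fix q assume q: "q \<in> C"
          show "(INF q\<in>C. q (t *\<^sub>R x)) / t \<le> q x"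
            using le[OF q, of "t *\<^sub>R x"] eq[OF q] t by (simp add: field_simps)
        qed
        then show "(INF q\<in>C. q (t *\<^sub>R x)) \<le> t * (INF q\<in>C. q x)"
          using t by (simp add: field_simps)
      next
        show "t * (INF q\<in>C. q x) \<le> (INF q\<in>C. q (t *\<^sub>R x))"
        proof (rule ge)
          fix q assume q: "q \<in> C"
          show "t * (INF q\<in>C. q x) \<le> q (t *\<^sub>R x)"
            unfolding eq[OF q] using t le[OF q, of x] by (intro mult_left_mono) auto
        qed
      qed
    qed
  qed
qed

lemma sublinear_minimal_below:
  assumes "sublinear p"
  obtains m where "sublinear m" "m \<le> p" "\<And>q. sublinear q \<Longrightarrow> q \<le> m \<Longrightarrow> q = m"
proof -
  define S where "S = {q. sublinear q \<and> q \<le> p}"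
  have "\<exists>m\<in>S. \<forall>q\<in>S. m \<ge> q \<longrightarrow> q = m"
  proof (rule predicate_Zorn)
    show "partial_order_on S (relation_of (\<ge>) S)"
      by (rule partial_order_on_relation_ofI) auto
    fix C assume C: "C \<in> Chains (relation_of (\<ge>) S)"
    show "\<exists>u\<in>S. \<forall>a\<in>C. a \<ge> u"
    proof (cases "C = {}")
      case True
      then show ?thesis using assms by (auto simp: S_def)
    next
      case False
      have CS: "C \<subseteq> S" and ch: "\<And>q r. q \<in> C \<Longrightarrow> r \<in> C \<Longrightarrow> q \<le> r \<or> r \<le> q"
        using C by (auto simp: Chains_def relation_of_def)
      note inf = sublinear_Inf_chain[OF False, of p]
      have s: "sublinear (\<lambda>x. INF q\<in>C. q x)"
        and l: "\<And>q x. q \<in> C \<Longrightarrow> (INF q\<in>C. q x) \<le> q x"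
        using inf ch CS unfolding S_def by blast+
      obtain q0 where q0: "q0 \<in> C" using False by blast
      have "(\<lambda>x. INF q\<in>C. q x) \<le> p"
      proof (rule le_funI)
        fix x
        have "(INF q\<in>C. q x) \<le> q0 x" using l q0 by blast
        also have "\<dots> \<le> p x" using q0 CS by (auto simp: S_def le_fun_def)
        finally show "(INF q\<in>C. q x) \<le> p x" .
      qed
      then show ?thesis
        using s l by (intro bexI[of _ "\<lambda>x. INF q\<in>C. q x"]) (auto simp: S_def le_fun_def)
    qed
  qed
  then obtain m where m: "m \<in> S" "\<And>q. q \<in> S \<Longrightarrow> q \<le> m \<Longrightarrow> q = m" by blast
  show ?thesis
    using m by (intro that[of m]) (auto simp: S_def intro: order_trans)
qed

lemma norming_functional:
  fixes g :: "'a::real_normed_vector"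
  shows "\<exists>\<phi>. linear \<phi> \<and> (\<forall>x. \<phi> x \<le> norm x) \<and> \<phi> g = norm g"
proof -
  have sn: "sublinear (norm :: 'a \<Rightarrow> real)"
    by (auto simp: sublinear_def norm_triangle_ineq)
  obtain m where m: "sublinear m" "m \<le> lower_at norm g"
    "\<And>q. sublinear q \<Longrightarrow> q \<le> m \<Longrightarrow> q = m"
    using sublinear_minimal_below[OF lower_at(1)[OF sn, of g]] by metis
  note m' = sublinearD[OF m(1)]
  \<comment> \<open>Minimality of \<open>m\<close> turns \<open>lower_at m y (- y) \<le> - m y\<close> into \<open>m (- y) \<le> - m y\<close>, so \<open>m\<close> is odd,
    and an odd sublinear functional is linear.\<close>
  have low: "lower_at m y = m" for y
    using lower_at[OF m(1)] by (intro m(3)) (auto simp: le_fun_def)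
  have neg: "m (- y) = - m y" for y
    using lower_at(3)[OF m(1), of y] m'(4)[of y] unfolding low by simp
  have "linear m"
  proof (rule linearI)
    fix x y
    show "m (x + y) = m x + m y"
      using m'(1)[of x y] m'(1)[of "- x" "- y"] neg[of "x + y"] neg[of x] neg[of y]
      by simp
    fix r :: real
    show "m (r *\<^sub>R x) = r *\<^sub>R m x"
      using m'(2)[of r x] m'(2)[of "- r" x] neg[of "r *\<^sub>R x"] by (cases "r \<ge> 0") auto
  qed
  moreover have le: "m x \<le> norm x" for x
    using m(2) lower_at(2)[OF sn, of g x] by (meson le_funE order_trans)
  moreover have "m g = norm g"
  proof -
    have "m (- g) \<le> lower_at norm g (- g)" using m(2) by (rule le_funE)
    also have "\<dots> \<le> - norm g" by (rule lower_at(3)[OF sn])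
    finally show ?thesis using neg[of g] le[of g] by simp
  qed
  ultimately show ?thesis by blast
qed

lemma eventually_cofin_norm_le:
  fixes g :: "'a::complex_banach"
  shows "\<forall>\<^sub>F x in cofin. norm g \<le> norm (g + x)"
proof -
  obtain \<phi> :: "'a \<Rightarrow> real" where \<phi>: "linear \<phi>" "\<And>x. \<phi> x \<le> norm x" "\<phi> g = norm g"
    using norming_functional[of g] by blast
  \<comment> \<open>The complex-linear functional with real part \<open>\<phi>\<close>.\<close>
  define \<Phi> where "\<Phi> x = Complex (\<phi> x) (- \<phi> (\<i> *\<^sub>C x))" for x
  have s: "c *\<^sub>C x = Re c *\<^sub>R x + Im c *\<^sub>R (\<i> *\<^sub>C x)" for c x
  proof -
    have "c = complex_of_real (Re c) + complex_of_real (Im c) * \<i>"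
      by (simp add: complex_eq_iff)
    then have "c *\<^sub>C x = (complex_of_real (Re c) + complex_of_real (Im c) * \<i>) *\<^sub>C x"
      by (rule arg_cong)
    also have "\<dots> = complex_of_real (Re c) *\<^sub>C x + complex_of_real (Im c) *\<^sub>C (\<i> *\<^sub>C x)"
      by (simp only: scaleC_add_left scaleC_scaleC)
    finally show ?thesis by (simp only: scaleC_of_real)
  qed
  have si: "\<i> *\<^sub>C (c *\<^sub>C x) = Re c *\<^sub>R (\<i> *\<^sub>C x) - Im c *\<^sub>R x" for c and x :: 'a
  proof -
    have "\<i> *\<^sub>C (c *\<^sub>C x) = (\<i> * c) *\<^sub>C x" by (simp add: scaleC_scaleC)
    also have "\<dots> = Re c *\<^sub>R (\<i> *\<^sub>C x) - Im c *\<^sub>R x" by (subst s) simp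
    finally show ?thesis .
  qed
  have "cfunctional \<Phi>"
    unfolding cfunctional_def
  proof (intro conjI allI)
    fix x y c
    show "\<Phi> (x + y) = \<Phi> x + \<Phi> y"
      by (simp add: \<Phi>_def linear_add[OF \<phi>(1)] scaleC.add_right complex_eq_iff)
    have "\<phi> (c *\<^sub>C x) = Re c * \<phi> x + Im c * \<phi> (\<i> *\<^sub>C x)"
      by (subst s) (simp add: linear_add[OF \<phi>(1)] linear_cmul[OF \<phi>(1)])
    moreover have "\<phi> (\<i> *\<^sub>C (c *\<^sub>C x)) = Re c * \<phi> (\<i> *\<^sub>C x) - Im c * \<phi> x"
      unfolding si by (simp add: linear_diff[OF \<phi>(1)] linear_cmul[OF \<phi>(1)])
    ultimately show "\<Phi> (c *\<^sub>C x) = c * \<Phi> x"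
      by (simp add: \<Phi>_def complex_eq_iff algebra_simps)
  qed
  moreover have "norm g \<le> norm (g + x)" if "\<Phi> x = 0" for x
  proof -
    have "norm g = \<phi> (g + x)"
      using that by (simp add: \<Phi>_def complex_eq_iff linear_add[OF \<phi>(1)] \<phi>(3))
    then show ?thesis using \<phi>(2) by simp
  qed
  ultimately show ?thesis
    unfolding eventually_cofin by (intro exI[of _ "{\<Phi>}"]) auto
qed

text \<open>Mazur's lemma: take norming functionals at the points of a finite net of \<open>K\<close>.\<close>

lemma eventually_cofin_compact:
  fixes K :: "'a::complex_banach set"
  assumes "compact K" "\<epsilon> > 0"
  shows "\<forall>\<^sub>F x in cofin. \<forall>g\<in>K. norm g \<le> norm (g + x) + \<epsilon>"
proof -
  obtain D where D: "finite D" "D \<subseteq> K" "K \<subseteq> (\<Union>d\<in>D. ball d (\<epsilon> / 2))"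
    using compactE_image[OF assms(1), of K "\<lambda>d. ball d (\<epsilon> / 2)"] assms(2)
    by (metis (no_types, lifting) UN_I centre_in_ball half_gt_zero open_ball subsetI)
  have "\<forall>\<^sub>F x in cofin. \<forall>d\<in>D. norm d \<le> norm (d + x)"
    using D(1) by (simp add: eventually_ball_finite_distrib eventually_cofin_norm_le)
  then show ?thesis
  proof (rule eventually_mono, intro ballI)
    fix x g assume x: "\<forall>d\<in>D. norm d \<le> norm (d + x)" and "g \<in> K"
    then obtain d where d: "d \<in> D" "norm (d - g) < \<epsilon> / 2"
      using D(3) by (auto simp: dist_norm)
    have "norm g \<le> norm d + norm (g - d)"
      using norm_triangle_ineq[of d "g - d"] by simp
    moreover have "norm (d + x) \<le> norm (g + x) + norm (d - g)"
      using norm_triangle_ineq[of "g + x" "d - g"] by (simp add: algebra_simps)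
    moreover have "norm d \<le> norm (d + x)" using x d(1) by blast
    ultimately show "norm g \<le> norm (g + x) + \<epsilon>"
      using d(2) norm_minus_commute[of d g] by linarith
  qed
qed

section \<open>Growth of powers from lower bounds on a disc\<close>

text \<open>The operator \<open>T - a\<close>.\<close>

definition shift :: "('a::complex_banach \<Rightarrow> 'a) \<Rightarrow> complex \<Rightarrow> 'a \<Rightarrow> 'a" where
  "shift T a x = T x - a *\<^sub>C x"

text \<open>The polynomial \<open>(s\<^sup>N - a\<^sup>N) / (s - a)\<close>, evaluated at \<open>s = T\<close>.\<close>

definition geom :: "('a::complex_banach \<Rightarrow> 'a) \<Rightarrow> complex \<Rightarrow> nat \<Rightarrow> 'a \<Rightarrow> 'a" where
  "geom T a N y = (\<Sum>k<N. a ^ (N - Suc k) *\<^sub>C (T ^^ k) y)"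

lemma clinear_shift: "clinear T \<Longrightarrow> clinear (shift T a)"
  unfolding shift_def[abs_def] by (intro clinear_minus clinear_scaled clinear_id)

lemma clinear_geom: "clinear T \<Longrightarrow> clinear (geom T a N)"
  unfolding geom_def[abs_def] by (intro clinear_sum_fun clinear_scaled clinear_funpow)

lemma shift_commute:
  "clinear T \<Longrightarrow> shift T a (shift T b x) = shift T b (shift T a x)"
  by (simp add: shift_def clinear_diff clinear_scale scaleC.diff_right scaleC_scaleC mult.commute)

lemma shift_diff: "shift T b x - shift T a x = (a - b) *\<^sub>C x"
  by (simp add: shift_def scaleC.diff_left)

lemma geom_Suc: "geom T a (Suc N) y = a *\<^sub>C geom T a N y + (T ^^ N) y"
proof -
  have "a ^ (Suc N - Suc k) = a * a ^ (N - Suc k)" if "k < N" for k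
    using that by (metis Suc_diff_Suc diff_Suc_Suc power_Suc)
  then have "(\<Sum>k<N. a ^ (Suc N - Suc k) *\<^sub>C (T ^^ k) y) = a *\<^sub>C geom T a N y"
    unfolding geom_def scaleC.sum_right scaleC_scaleC by (intro sum.cong) auto
  then show ?thesis by (simp add: geom_def)
qed

lemma shift_geom:
  assumes "clinear T"
  shows "shift T a (geom T a N y) = shift (T ^^ N) (a ^ N) y"
proof (induction N)
  case 0
  then show ?case by (simp add: shift_def geom_def clinear_zero[OF assms])
next
  case (Suc N)
  have "shift T a (geom T a (Suc N) y) = a *\<^sub>C shift T a (geom T a N y) + shift T a ((T ^^ N) y)"
    using clinear_shift[OF assms, of a] by (simp add: geom_Suc clinear_add clinear_scale)
  also have "\<dots> = shift (T ^^ Suc N) (a ^ Suc N) y"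
    unfolding Suc by (simp add: shift_def scaleC.diff_right scaleC_scaleC)
  finally show ?case .
qed

text \<open>The \<open>j\<close>-th power of a primitive \<open>N\<close>-th root of unity.\<close>

definition root_of_one :: "nat \<Rightarrow> nat \<Rightarrow> complex" where
  "root_of_one N j = exp (2 * of_real pi * \<i> * of_nat j / of_nat N)"

lemma root_of_one:
  assumes "N > 0"
  shows "root_of_one N j ^ N = 1" "cmod (root_of_one N j) = 1"
proof -
  show "root_of_one N j ^ N = 1"
    using complex_root_unity[of N j] assms by (simp add: root_of_one_def)
  show "cmod (root_of_one N j) = 1"
    by (simp add: root_of_one_def)
qed

lemma sum_root_of_one_power:
  assumes "m < N"
  shows "(\<Sum>j<N. root_of_one N j ^ m) = (if m = 0 then of_nat N else 0)"
proof (cases "m = 0")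
  case False
  have eq: "root_of_one N j ^ m = root_of_one N m ^ j" for j
    by (simp add: root_of_one_def flip: exp_of_nat_mult) (simp add: mult_ac)
  have "root_of_one N m \<noteq> 1"
    using complex_root_unity_eq_1[of N m] False assms
    by (auto simp: root_of_one_def dest: dvd_imp_le)
  then show ?thesis
    using False root_of_one(1)[of N m] assms by (simp add: eq sum_gp_strict)
qed simp

text \<open>Averaging over the \<open>N\<close>-th roots of unity leaves only the term of \<open>geom\<close> that does not
  contain \<open>a\<close>.\<close>

lemma sum_geom_roots:
  assumes "N > 0"
  shows "(\<Sum>j<N. geom T (r * root_of_one N j) N y) = of_nat N *\<^sub>C (T ^^ (N - 1)) y"
proof -
  have "(\<Sum>j<N. geom T (r * root_of_one N j) N y) =
      (\<Sum>k<N. \<Sum>j<N. (r ^ (N - Suc k) * root_of_one N j ^ (N - Suc k)) *\<^sub>C (T ^^ k) y)"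
    unfolding geom_def power_mult_distrib by (rule sum.swap)
  also have "\<dots> = (\<Sum>k<N. (r ^ (N - Suc k) * (\<Sum>j<N. root_of_one N j ^ (N - Suc k))) *\<^sub>C (T ^^ k) y)"
    by (simp add: scaleC.sum_left sum_distrib_left)
  also have "\<dots> = (\<Sum>k<N. if k = N - 1 then of_nat N *\<^sub>C (T ^^ k) y else 0)"
    by (intro sum.cong) (auto simp: sum_root_of_one_power)
  also have "\<dots> = of_nat N *\<^sub>C (T ^^ (N - 1)) y"
    using assms by simp
  finally show ?thesis .
qed

text \<open>The resolvent identity \<open>(T - a)\<^sup>-\<^sup>1 - (T - b)\<^sup>-\<^sup>1 = (a - b) (T - a)\<^sup>-\<^sup>1 (T - b)\<^sup>-\<^sup>1\<close>, multiplied by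
  \<open>(T\<^sup>N - a\<^sup>N) (T\<^sup>N - b\<^sup>N)\<close> so that no inverse is needed; the lower bounds replace the bounds for
  the resolvents.\<close>

lemma geom_difference_bound:
  assumes T: "clinear T" and c: "c > 0"
    and a: "\<forall>\<^sub>F y in cofin. c * norm y \<le> norm (shift T a y)"
    and b: "\<forall>\<^sub>F y in cofin. c * norm y \<le> norm (shift T b y)"
  shows "\<forall>\<^sub>F y in cofin.
    c\<^sup>2 * norm (geom T a N (shift (T ^^ N) (b ^ N) y) - geom T b N (shift (T ^^ N) (a ^ N) y))
      \<le> cmod (a - b) * norm (shift (T ^^ N) (a ^ N) (shift (T ^^ N) (b ^ N) y))"
proof -
  define A where "A = T ^^ N"
  have A: "clinear A" unfolding A_def using T by (rule clinear_funpow)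
  define d where "d y = geom T a N (shift A (b ^ N) y) - geom T b N (shift A (a ^ N) y)" for y
  have d: "clinear d"
    unfolding d_def[abs_def] by (intro clinear_minus clinear_compose[OF clinear_geom[OF T] clinear_shift[OF A]])
  have "shift T a (shift T b (d y)) = (a - b) *\<^sub>C shift A (a ^ N) (shift A (b ^ N) y)" for y
  proof -
    have "shift T a (shift T b (d y)) =
        shift T b (shift T a (geom T a N (shift A (b ^ N) y)))
        - shift T a (shift T b (geom T b N (shift A (a ^ N) y)))"
      unfolding d_def using T by (simp add: clinear_diff[OF clinear_shift] shift_commute[of T a b])
    also have "\<dots> = shift T b (shift A (a ^ N) (shift A (b ^ N) y))
        - shift T a (shift A (a ^ N) (shift A (b ^ N) y))"
      using T by (simp add: shift_geom A_def[symmetric] shift_commute[OF A, of "b ^ N" "a ^ N"])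
    finally show ?thesis by (simp add: shift_diff)
  qed
  moreover have "\<forall>\<^sub>F y in cofin. c * norm (d y) \<le> norm (shift T b (d y))"
    using b d by (rule eventually_cofin_clinear)
  moreover have "\<forall>\<^sub>F y in cofin. c * norm (shift T b (d y)) \<le> norm (shift T a (shift T b (d y)))"
    using a clinear_compose[OF clinear_shift[OF T] d] by (rule eventually_cofin_clinear)
  ultimately have "\<forall>\<^sub>F y in cofin. c * norm (d y) \<le> norm (shift T b (d y)) \<and>
      c * norm (shift T b (d y)) \<le> cmod (a - b) * norm (shift A (a ^ N) (shift A (b ^ N) y))"
    by (simp add: eventually_conj_iff norm_scaleC)
  then have "\<forall>\<^sub>F y in cofin. c\<^sup>2 * norm (d y)
      \<le> cmod (a - b) * norm (shift A (a ^ N) (shift A (b ^ N) y))"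
  proof (rule eventually_mono)
    fix y
    assume y: "c * norm (d y) \<le> norm (shift T b (d y)) \<and>
      c * norm (shift T b (d y)) \<le> cmod (a - b) * norm (shift A (a ^ N) (shift A (b ^ N) y))"
    have "c\<^sup>2 * norm (d y) = c * (c * norm (d y))" by (simp add: power2_eq_square)
    also have "\<dots> \<le> c * norm (shift T b (d y))" using y c by (intro mult_left_mono) auto
    finally show "c\<^sup>2 * norm (d y) \<le> cmod (a - b) * norm (shift A (a ^ N) (shift A (b ^ N) y))"
      using y by linarith
  qed
  then show ?thesis by (simp add: d_def A_def)
qed

text \<open>The average of \<open>geom_difference_bound\<close> over \<open>a = r \<omega>\<close> and \<open>b = r' \<omega>\<close>, where \<open>\<omega>\<close> runs through
  the \<open>N\<close>-th roots of unity. The factor \<open>\<bar>r - r'\<bar>\<close> on the right does not depend on \<open>N\<close>.\<close>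

lemma power_resolvent_bound:
  fixes r r' :: real
  assumes T: "clinear T" and L: "\<And>x. norm (T x) \<le> L * norm x" "L \<ge> 0" and c: "c > 0"
    and r: "\<And>a. cmod a = \<bar>r\<bar> \<Longrightarrow> \<forall>\<^sub>F y in cofin. c * norm y \<le> norm (shift T a y)"
    and r': "\<And>a. cmod a = \<bar>r'\<bar> \<Longrightarrow> \<forall>\<^sub>F y in cofin. c * norm y \<le> norm (shift T a y)"
    and N: "N > 0"
  shows "\<forall>\<^sub>F y in cofin. c\<^sup>2 * (\<bar>r ^ N - r' ^ N\<bar> * norm ((T ^^ N) y))
      \<le> L * \<bar>r - r'\<bar> * norm (shift (T ^^ N) (of_real (r ^ N)) (shift (T ^^ N) (of_real (r' ^ N)) y))"
proof -
  define A where "A = T ^^ N"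
  define a where "a j = of_real r * root_of_one N j" for j
  define b where "b j = of_real r' * root_of_one N j" for j
  have aN: "a j ^ N = of_real (r ^ N)" and bN: "b j ^ N = of_real (r' ^ N)" for j
    using root_of_one[OF N] by (simp_all add: a_def b_def power_mult_distrib)
  have ab: "cmod (a j - b j) = \<bar>r - r'\<bar>" for j
  proof -
    have "a j - b j = of_real (r - r') * root_of_one N j"
      by (simp add: a_def b_def algebra_simps)
    then show ?thesis using root_of_one[OF N] by (simp add: norm_mult del: of_real_diff)
  qed
  have ca: "cmod (a j) = \<bar>r\<bar>" and cb: "cmod (b j) = \<bar>r'\<bar>" for j
    using root_of_one[OF N] by (simp_all add: a_def b_def norm_mult)
  define d where "d j y = geom T (a j) N (shift A (of_real (r' ^ N)) y)
      - geom T (b j) N (shift A (of_real (r ^ N)) y)" for j y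
  define X where "X y = shift A (of_real (r ^ N)) (shift A (of_real (r' ^ N)) y)" for y
  have "\<forall>\<^sub>F y in cofin. c\<^sup>2 * norm (d j y) \<le> \<bar>r - r'\<bar> * norm (X y)" for j
    using geom_difference_bound[OF T c r[OF ca[of j]] r'[OF cb[of j]], of N]
    by (simp only: aN bN ab d_def X_def A_def)
  then have "\<forall>\<^sub>F y in cofin. \<forall>j\<in>{..<N}. c\<^sup>2 * norm (d j y) \<le> \<bar>r - r'\<bar> * norm (X y)"
    by (simp add: eventually_ball_finite)
  then have "\<forall>\<^sub>F y in cofin. c\<^sup>2 * (\<bar>r ^ N - r' ^ N\<bar> * norm (A y)) \<le> L * \<bar>r - r'\<bar> * norm (X y)"
  proof (rule eventually_mono)
    fix y
    assume y: "\<forall>j\<in>{..<N}. c\<^sup>2 * norm (d j y) \<le> \<bar>r - r'\<bar> * norm (X y)"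
    have "T (\<Sum>j<N. d j y) = T (of_nat N *\<^sub>C (T ^^ (N - 1))
        (shift A (of_real (r' ^ N)) y - shift A (of_real (r ^ N)) y))"
      unfolding d_def sum_subtractf a_def b_def
      using N by (simp add: sum_geom_roots clinear_diff[OF clinear_funpow[OF T]] scaleC.diff_right)
    also have "\<dots> = (of_nat N * of_real (r ^ N - r' ^ N)) *\<^sub>C T ((T ^^ (N - 1)) y)"
      by (simp add: shift_diff clinear_scale[OF T] clinear_scale[OF clinear_funpow[OF T]] scaleC_scaleC)
    also have "T ((T ^^ (N - 1)) y) = A y"
      using N unfolding A_def by (cases N) auto
    finally have "real N * (\<bar>r ^ N - r' ^ N\<bar> * norm (A y)) = norm (T (\<Sum>j<N. d j y))"
      by (simp add: norm_scaleC norm_mult del: of_real_diff of_real_power)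
    also have "\<dots> \<le> L * (\<Sum>j<N. norm (d j y))"
      using L norm_sum[of "\<lambda>j. d j y" "{..<N}"] by (meson mult_left_mono order_trans)
    finally have "c\<^sup>2 * (real N * (\<bar>r ^ N - r' ^ N\<bar> * norm (A y)))
        \<le> c\<^sup>2 * (L * (\<Sum>j<N. norm (d j y)))"
      by (intro mult_left_mono) auto
    also have "\<dots> = L * (\<Sum>j<N. c\<^sup>2 * norm (d j y))"
      by (simp add: sum_distrib_left mult.left_commute)
    also have "\<dots> \<le> L * (\<Sum>j<N. \<bar>r - r'\<bar> * norm (X y))"
      using y L(2) by (intro mult_left_mono sum_mono) auto
    also have "\<dots> = real N * (L * \<bar>r - r'\<bar> * norm (X y))" by simp
    finally have "real N * (c\<^sup>2 * (\<bar>r ^ N - r' ^ N\<bar> * norm (A y)))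
        \<le> real N * (L * \<bar>r - r'\<bar> * norm (X y))" by (simp add: mult.left_commute)
    then show "c\<^sup>2 * (\<bar>r ^ N - r' ^ N\<bar> * norm (A y)) \<le> L * \<bar>r - r'\<bar> * norm (X y)"
      using N by simp
  qed
  then show ?thesis by (simp add: A_def X_def)
qed

text \<open>\<open>power_bounded_below T r\<close>: some power \<open>T ^^ N\<close> is bounded below by \<open>r ^ N\<close> on a subspace of
  finite codimension.\<close>

definition power_bounded_below :: "('a::complex_banach \<Rightarrow> 'a) \<Rightarrow> real \<Rightarrow> bool" where
  "power_bounded_below T r \<longleftrightarrow> (\<exists>N>0. \<forall>\<^sub>F y in cofin. r ^ N * norm y \<le> norm ((T ^^ N) y))"

lemma power_lower_bound_iterate:
  assumes T: "clinear T" and r: "r \<ge> 0"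
    and N: "\<forall>\<^sub>F y in cofin. r ^ N * norm y \<le> norm ((T ^^ N) y)"
  shows "\<forall>\<^sub>F y in cofin. r ^ (k * N) * norm y \<le> norm ((T ^^ (k * N)) y)"
proof (induction k)
  case (Suc k)
  have "\<forall>\<^sub>F y in cofin. r ^ N * norm ((T ^^ (k * N)) y) \<le> norm ((T ^^ N) ((T ^^ (k * N)) y))"
    using N clinear_funpow[OF T] by (rule eventually_cofin_clinear)
  with Suc show ?case
  proof eventually_elim
    case (elim y)
    have "r ^ (Suc k * N) * norm y = r ^ N * (r ^ (k * N) * norm y)"
      by (simp add: power_add)
    also have "\<dots> \<le> r ^ N * norm ((T ^^ (k * N)) y)"
      using elim(1) r by (intro mult_left_mono) auto
    also have "\<dots> \<le> norm ((T ^^ (Suc k * N)) y)"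
      using elim(2) by (simp add: funpow_add)
    finally show ?case .
  qed
qed simp

text \<open>Write \<open>A = T\<^sup>N\<close> and \<open>\<rho> = (r + \<delta>)\<^sup>N\<close> with \<open>N\<close> so large that \<open>r\<^sup>N \<le> \<rho> / 2\<close>. If \<open>A\<close> is bounded below
  by \<open>r\<^sup>N\<close>, then \<open>A - r\<^sup>N\<close> is at most \<open>2 A\<close> in norm, and \<open>power_resolvent_bound\<close> for the radii \<open>r\<close>
  and \<open>r + \<delta>\<close> shows that \<open>A\<close> is bounded below by \<open>\<rho>\<close>, though only on the range of \<open>A\<close>. So \<open>A\<^sup>2\<close> is
  bounded below by \<open>\<rho> r\<^sup>N\<close>, which still improves on \<open>r\<^sup>2\<^sup>N\<close>.\<close>

lemma power_bounded_below_step: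
  assumes T: "clinear T" and L: "\<And>x. norm (T x) \<le> L * norm x" "L \<ge> 0" and c: "c > 0"
    and \<delta>: "\<delta> > 0" "12 * \<delta> * L \<le> c\<^sup>2" and r: "\<delta> \<le> r"
    and low: "\<And>a. cmod a \<le> r + \<delta> \<Longrightarrow> \<forall>\<^sub>F y in cofin. c * norm y \<le> norm (shift T a y)"
    and pb: "power_bounded_below T r"
  shows "power_bounded_below T (r + \<delta> / 3)"
proof -
  obtain N0 where N0: "N0 > 0" "\<forall>\<^sub>F y in cofin. r ^ N0 * norm y \<le> norm ((T ^^ N0) y)"
    using pb by (auto simp: power_bounded_below_def)
  have "\<exists>k. (r / (r + \<delta>)) ^ k < 1 / 2"
    using \<delta> r by (intro real_arch_pow_inv) auto
  then obtain k where k: "(r / (r + \<delta>)) ^ k < 1 / 2" by blast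
  \<comment> \<open>A multiple of \<open>N0\<close> that is at least \<open>k\<close>.\<close>
  define N where "N = Suc k * N0"
  have "k \<le> k * N0" using N0(1) by simp
  then have N: "N > 0" "k \<le> N" using N0(1) by (simp_all add: N_def trans_le_add2)
  have rN: "\<forall>\<^sub>F y in cofin. r ^ N * norm y \<le> norm ((T ^^ N) y)"
    unfolding N_def using T N0(2) r \<delta> by (intro power_lower_bound_iterate) auto
  define A where "A = T ^^ N"
  define \<rho> where "\<rho> = (r + \<delta>) ^ N"
  have A: "clinear A" unfolding A_def using T by (rule clinear_funpow)
  have \<rho>: "\<rho> > 0" "r ^ N \<le> \<rho> / 2"
  proof -
    show "\<rho> > 0" unfolding \<rho>_def using \<delta> r by simp
    have "(r / (r + \<delta>)) ^ N \<le> (r / (r + \<delta>)) ^ k"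
      using \<delta> r N(2) by (intro power_decreasing) auto
    then have "r ^ N / \<rho> \<le> 1 / 2"
      using k by (simp only: \<rho>_def power_divide)
    then show "r ^ N \<le> \<rho> / 2" using \<open>\<rho> > 0\<close> by (simp add: field_simps)
  qed
  have "\<forall>\<^sub>F y in cofin. c\<^sup>2 * (\<bar>r ^ N - (r + \<delta>) ^ N\<bar> * norm ((T ^^ N) y))
      \<le> L * \<bar>r - (r + \<delta>)\<bar> *
        norm (shift (T ^^ N) (of_real (r ^ N)) (shift (T ^^ N) (of_real ((r + \<delta>) ^ N)) y))"
    by (rule power_resolvent_bound[OF T L c _ _ N(1)]; rule low) (use \<delta> r in auto)
  moreover have "\<forall>\<^sub>F y in cofin. r ^ N * norm (shift A \<rho> y) \<le> norm (A (shift A \<rho> y))"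
    using eventually_cofin_clinear[OF rN clinear_shift[OF A]] by (simp add: A_def)
  ultimately have "\<forall>\<^sub>F y in cofin. \<rho> * norm (A y) \<le> norm (A (A y))"
  proof eventually_elim
    case (elim y)
    have eq: "shift A \<rho> y = A y - \<rho> *\<^sub>R y" for y
      by (simp add: shift_def scaleC_of_real)
    have e1: "norm (shift A (of_real (r ^ N)) (shift A \<rho> y)) \<le> 2 * norm (A (shift A \<rho> y))"
    proof -
      have "norm (shift A (of_real (r ^ N)) (shift A \<rho> y))
          \<le> norm (A (shift A \<rho> y)) + r ^ N * norm (shift A \<rho> y)"
        unfolding shift_def[of A "of_real (r ^ N)"]
        by (rule order_trans[OF norm_triangle_ineq4]) (use r \<delta> in \<open>simp add: norm_scaleC norm_power\<close>)
      then show ?thesis using elim(2) by simp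
    qed
    have "A (shift A \<rho> y) = A (A y) - \<rho> *\<^sub>R A y"
      by (simp add: eq clinear_diff[OF A] clinear_scaleR[OF A])
    then have e2: "norm (A (shift A \<rho> y)) \<le> norm (A (A y)) + \<rho> * norm (A y)"
      using norm_triangle_ineq4[of "A (A y)" "\<rho> *\<^sub>R A y"] \<rho>(1) by simp
    have "c\<^sup>2 * ((\<rho> - r ^ N) * norm (A y)) \<le> L * \<delta> * norm (shift A (of_real (r ^ N)) (shift A \<rho> y))"
      using elim(1) \<rho> \<delta>(1) unfolding A_def[symmetric] \<rho>_def[symmetric] by (simp add: abs_if)
    also have "\<dots> \<le> L * \<delta> * (2 * (norm (A (A y)) + \<rho> * norm (A y)))"
      using e1 e2 L(2) \<delta>(1) by (intro mult_left_mono) auto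
    also have "\<dots> = (12 * \<delta> * L) * ((norm (A (A y)) + \<rho> * norm (A y)) / 6)"
      by (simp add: algebra_simps)
    also have "\<dots> \<le> c\<^sup>2 * ((norm (A (A y)) + \<rho> * norm (A y)) / 6)"
      using \<rho>(1) \<delta>(2) by (intro mult_right_mono) auto
    finally have e3: "(\<rho> - r ^ N) * norm (A y) \<le> (norm (A (A y)) + \<rho> * norm (A y)) / 6"
      using c by simp
    have "(\<rho> / 2) * norm (A y) \<le> (\<rho> - r ^ N) * norm (A y)"
      using \<rho>(2) by (intro mult_right_mono) auto
    then have "(\<rho> / 2) * norm (A y) \<le> (norm (A (A y)) + \<rho> * norm (A y)) / 6"
      using e3 by (rule order_trans)
    moreover have "0 \<le> \<rho> * norm (A y)" using \<rho>(1) by simp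
    ultimately show ?case by simp
  qed
  with rN have "\<forall>\<^sub>F y in cofin. (r + \<delta> / 3) ^ (2 * N) * norm y \<le> norm ((T ^^ (2 * N)) y)"
  proof eventually_elim
    case (elim y)
    have "(r + \<delta> / 3)\<^sup>2 \<le> r * (r + \<delta>)"
      using \<delta>(1) r mult_left_mono[of \<delta> "3 * r" \<delta>] by (simp add: power2_eq_square field_simps)
    then have "(r + \<delta> / 3) ^ (2 * N) \<le> (r * (r + \<delta>)) ^ N"
      unfolding power_mult by (rule power_mono) simp
    then have "(r + \<delta> / 3) ^ (2 * N) * norm y \<le> (r * (r + \<delta>)) ^ N * norm y"
      by (rule mult_right_mono) simp
    also have "\<dots> = \<rho> * (r ^ N * norm y)"
      by (simp add: \<rho>_def power_mult_distrib)
    also have "\<dots> \<le> \<rho> * norm (A y)"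
      using elim(1) \<rho>(1) by (intro mult_left_mono) (auto simp: A_def)
    also have "\<dots> \<le> norm ((T ^^ (2 * N)) y)"
      using elim(2) by (simp add: A_def mult_2 funpow_add)
    finally show ?case .
  qed
  then show ?thesis
    unfolding power_bounded_below_def using N(1) by (intro exI[of _ "2 * N"]) auto
qed

lemma uniform_lower_bound_disc:
  assumes "\<And>a. cmod a \<le> 1 \<Longrightarrow> \<exists>c>0. \<forall>\<^sub>F y in cofin. c * norm y \<le> norm (shift T a y)"
  obtains c where "c > 0" "c \<le> 1"
    "\<And>a. cmod a \<le> 1 + c \<Longrightarrow> \<forall>\<^sub>F y in cofin. c * norm y \<le> norm (shift T a y)"
proof -
  \<comment> \<open>Lower bounds are stable under small changes of the parameter.\<close>
  have near: "\<forall>\<^sub>F y in cofin. (c - e) * norm y \<le> norm (shift T b y)"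
    if "\<forall>\<^sub>F y in cofin. c * norm y \<le> norm (shift T a y)" "cmod (b - a) \<le> e" for a b c e
    using that(1)
  proof eventually_elim
    case (elim y)
    have "shift T a y = shift T b y + (b - a) *\<^sub>C y"
      using shift_diff[of T a y b] by (simp add: algebra_simps)
    then have "norm (shift T a y) \<le> norm (shift T b y) + cmod (b - a) * norm y"
      using norm_triangle_ineq[of "shift T b y" "(b - a) *\<^sub>C y"] by (simp add: norm_scaleC)
    also have "\<dots> \<le> norm (shift T b y) + e * norm y"
      using that(2) by (intro add_left_mono mult_right_mono) auto
    finally show ?case using elim by (simp add: algebra_simps)
  qed
  obtain C where C: "\<And>a. cmod a \<le> 1 \<Longrightarrow> C a > 0"
    "\<And>a. cmod a \<le> 1 \<Longrightarrow> \<forall>\<^sub>F y in cofin. C a * norm y \<le> norm (shift T a y)"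
    using assms by metis
  obtain D where D: "D \<subseteq> cball 0 1" "finite D" "cball 0 1 \<subseteq> (\<Union>a\<in>D. ball a (C a / 2))"
  proof (rule compactE_image[OF compact_cball[of "0::complex" 1], of "cball 0 1" "\<lambda>a. ball a (C a / 2)"])
    show "cball 0 1 \<subseteq> (\<Union>a\<in>cball 0 1. ball a (C a / 2))"
      using C(1) by (force intro!: bexI)
  qed auto
  have "D \<noteq> {}"
    using D(3) by (metis UN_empty cball_eq_empty less_eq_real_def not_one_less_zero subset_empty)
  define m where "m = Min (insert 2 (C ` D)) / 4"
  have m: "m > 0" "m \<le> 1" "\<And>a. a \<in> D \<Longrightarrow> 4 * m \<le> C a"
  proof -
    have "Min (insert 2 (C ` D)) > 0"
      using D C(1) by (subst Min_gr_iff) auto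
    then show "m > 0" by (simp add: m_def)
    have "Min (insert 2 (C ` D)) \<le> 2"
      using D(2) by (intro Min_le) auto
    then show "m \<le> 1" by (simp add: m_def)
    show "4 * m \<le> C a" if "a \<in> D" for a
      unfolding m_def using that D(2) by simp
  qed
  have "\<forall>\<^sub>F y in cofin. m * norm y \<le> norm (shift T b y)" if b: "cmod b \<le> 1 + m" for b
  proof -
    \<comment> \<open>The point of the unit disc nearest to \<open>b\<close>.\<close>
    define b' where "b' = b / of_real (max 1 (cmod b))"
    have b'1: "cmod b' \<le> 1" by (simp add: b'_def norm_divide)
    have bb': "cmod (b - b') \<le> m"
    proof (cases "cmod b \<le> 1")
      case True
      then show ?thesis using m by (simp add: b'_def max_def)
    next
      case False
      then have "b \<noteq> 0" by (intro notI) simp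
      with False have "b - b' = b * of_real (1 - 1 / cmod b)"
        by (simp add: b'_def algebra_simps)
      then have "cmod (b - b') = cmod b * \<bar>1 - 1 / cmod b\<bar>"
        by (metis norm_mult norm_of_real)
      also have "\<dots> = cmod b - 1"
        using False \<open>b \<noteq> 0\<close> by (simp add: field_simps abs_if)
      finally show ?thesis using b by simp
    qed
    have "b' \<in> cball 0 1" using b'1 by simp
    then obtain a where a: "a \<in> D" "b' \<in> ball a (C a / 2)" using D(3) by blast
    have "cmod (b' - a) \<le> C a / 2"
      using a(2) by (simp add: dist_norm norm_minus_commute)
    moreover have "cmod (b - a) \<le> cmod (b - b') + cmod (b' - a)"
      using norm_triangle_ineq[of "b - b'" "b' - a"] by simp
    ultimately have "cmod (b - a) \<le> C a - m"
      using bb' m(3)[OF a(1)] m(1) by simp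
    then have "\<forall>\<^sub>F y in cofin. (C a - (C a - m)) * norm y \<le> norm (shift T b y)"
      using a D(1) by (intro near[OF C(2)]) auto
    then show ?thesis by simp
  qed
  with m show ?thesis using that by blast
qed

text \<open>Start with the radius \<open>c\<close>, given by the lower bound for \<open>T\<close> itself, and iterate the step. The
  step is available as long as \<open>r \<le> 1\<close>, because \<open>r + \<delta> \<le> 1 + c\<close> then.\<close>

lemma power_bounded_below_gt_1:
  assumes T: "clinear T" and L: "\<And>x. norm (T x) \<le> L * norm x" "L \<ge> 1"
    and c: "c > 0" "c \<le> 1"
    and low: "\<And>a. cmod a \<le> 1 + c \<Longrightarrow> \<forall>\<^sub>F y in cofin. c * norm y \<le> norm (shift T a y)"
  shows "\<exists>r>1. power_bounded_below T r"
proof -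
  define \<delta> where "\<delta> = c\<^sup>2 / (12 * L)"
  have \<delta>: "\<delta> > 0" "12 * \<delta> * L \<le> c\<^sup>2" using c L(2) by (auto simp: \<delta>_def)
  have "c\<^sup>2 \<le> c * 1" unfolding power2_eq_square using c by (intro mult_left_mono) auto
  also have "\<dots> \<le> c * (12 * L)" using c L(2) by (intro mult_left_mono) auto
  finally have \<delta>c: "\<delta> \<le> c" unfolding \<delta>_def using L(2) by (simp add: field_simps)
  have "(\<exists>r>1. power_bounded_below T r) \<or>
      (\<exists>r. c + real k * (\<delta> / 3) \<le> r \<and> r \<le> 1 \<and> power_bounded_below T r)" for k
  proof (induction k)
    case 0
    have "power_bounded_below T c"
      unfolding power_bounded_below_def
      using low[of 0] c by (intro exI[of _ 1]) (simp add: shift_def)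
    then show ?case using c by auto
  next
    case (Suc k)
    consider "\<exists>r>1. power_bounded_below T r"
      | r where "c + real k * (\<delta> / 3) \<le> r" "r \<le> 1" "power_bounded_below T r"
      using Suc by blast
    then show ?case
    proof cases
      case 2
      have "c \<le> r" using 2(1) \<delta>(1) by (smt (verit) divide_nonneg_nonneg mult_nonneg_nonneg of_nat_0_le_iff)
      have "power_bounded_below T (r + \<delta> / 3)"
        using \<open>c \<le> r\<close> \<delta>c 2 L(2)
        by (intro power_bounded_below_step[OF T L(1) _ c(1) \<delta>] low) auto
      moreover have "c + real (Suc k) * (\<delta> / 3) \<le> r + \<delta> / 3"
        using 2(1) by (simp add: algebra_simps add_divide_distrib)
      ultimately show ?thesis by (meson not_le)
    qed simp
  qed
  moreover obtain k where "1 < real k * (\<delta> / 3)"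
    using \<delta>(1) reals_Archimedean3[of "\<delta> / 3"] by (metis divide_pos_pos zero_less_numeral)
  ultimately show ?thesis using c by (smt (verit))
qed

text \<open>In the terminology of Fredholm theory: \<open>T - a\<close> is not upper semi-Fredholm for some \<open>a\<close> in the
  closed unit disc.\<close>

lemma shift_not_bounded_below:
  assumes T: "clinear T" and L: "\<And>x. norm (T x) \<le> L * norm x" "L \<ge> 1"
    and E: "csubspace E" "infinite_dimensional E"
    and \<psi>: "strict_mono (\<psi> :: nat \<Rightarrow> nat)"
    and bdd: "\<And>n x. x \<in> E \<Longrightarrow> norm ((T ^^ \<psi> n) x) \<le> C * norm x"
  shows "\<exists>a. cmod a \<le> 1 \<and> (\<forall>c>0. \<exists>\<^sub>F y in cofin. norm (shift T a y) < c * norm y)"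
proof (rule ccontr)
  assume "\<not> ?thesis"
  then have "\<exists>c>0. \<not> (\<exists>\<^sub>F y in cofin. norm (shift T a y) < c * norm y)" if "cmod a \<le> 1" for a
    using that by blast
  then have "\<exists>c>0. \<forall>\<^sub>F y in cofin. c * norm y \<le> norm (shift T a y)" if "cmod a \<le> 1" for a
    using that by (simp add: not_frequently not_less)
  then obtain c where c: "c > 0" "c \<le> 1"
    "\<And>a. cmod a \<le> 1 + c \<Longrightarrow> \<forall>\<^sub>F y in cofin. c * norm y \<le> norm (shift T a y)"
    using uniform_lower_bound_disc by blast
  obtain r N where r: "r > 1" and N: "N > 0" "\<forall>\<^sub>F y in cofin. r ^ N * norm y \<le> norm ((T ^^ N) y)"
    using power_bounded_below_gt_1[OF T L c(1,2) c(3)] by (auto simp: power_bounded_below_def)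
  have "r ^ N > 1" using r N(1) by simp
  then obtain q0 where q0: "C / c ^ N < (r ^ N) ^ q0"
    using real_arch_pow by blast
  define n where "n = \<psi> (q0 * N)"
  define q where "q = n div N"
  define t where "t = n mod N"
  have "q0 * N \<le> n" unfolding n_def using \<psi> by (rule strict_mono_imp_increasing)
  then have "q0 \<le> q" unfolding q_def using N(1) by (simp add: less_eq_div_iff_mult_less_eq)
  have n: "n = t + q * N" by (simp add: q_def t_def)
  have "\<forall>\<^sub>F y in cofin. r ^ (q * N) * norm y \<le> norm ((T ^^ (q * N)) y)"
    using T r N(2) by (intro power_lower_bound_iterate) auto
  moreover have "\<forall>\<^sub>F y in cofin. c * norm y \<le> norm (T y)"
    using c(3)[of 0] c(1) by (simp add: shift_def)
  then have "\<forall>\<^sub>F y in cofin. c ^ 1 * norm y \<le> norm ((T ^^ 1) y)" by simp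
  then have "\<forall>\<^sub>F y in cofin. c ^ (t * 1) * norm y \<le> norm ((T ^^ (t * 1)) y)"
    using c(1) by (intro power_lower_bound_iterate[OF T]) simp
  then have "\<forall>\<^sub>F y in cofin. c ^ t * norm y \<le> norm ((T ^^ t) y)"
    by simp
  then have "\<forall>\<^sub>F y in cofin. c ^ t * norm ((T ^^ (q * N)) y) \<le> norm ((T ^^ t) ((T ^^ (q * N)) y))"
    using clinear_funpow[OF T] by (rule eventually_cofin_clinear)
  ultimately have ev: "\<forall>\<^sub>F y in cofin. r ^ (q * N) * norm y \<le> norm ((T ^^ (q * N)) y) \<and>
      c ^ t * norm ((T ^^ (q * N)) y) \<le> norm ((T ^^ t) ((T ^^ (q * N)) y))"
    by (rule eventually_conj)
  then obtain y where y: "y \<in> E" "y \<noteq> 0" "r ^ (q * N) * norm y \<le> norm ((T ^^ (q * N)) y)"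
    "c ^ t * norm ((T ^^ (q * N)) y) \<le> norm ((T ^^ t) ((T ^^ (q * N)) y))"
    using eventually_cofin_meets[OF E ev] by blast
  have "c ^ N * (r ^ N) ^ q0 \<le> c ^ t * r ^ (q * N)"
  proof (rule mult_mono)
    show "c ^ N \<le> c ^ t" using c N(1) by (intro power_decreasing) (auto simp: t_def less_imp_le)
    have "(r ^ N) ^ q0 \<le> (r ^ N) ^ q"
      using \<open>q0 \<le> q\<close> \<open>r ^ N > 1\<close> by (intro power_increasing) auto
    then show "(r ^ N) ^ q0 \<le> r ^ (q * N)" by (simp add: mult.commute flip: power_mult)
  qed (use c r in auto)
  then have "c ^ N * (r ^ N) ^ q0 * norm y \<le> c ^ t * (r ^ (q * N) * norm y)"
    by (simp add: mult_right_mono flip: mult.assoc)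
  also have "\<dots> \<le> c ^ t * norm ((T ^^ (q * N)) y)"
    using y(3) c by (intro mult_left_mono) auto
  also have "\<dots> \<le> norm ((T ^^ n) y)"
    using y(4) by (simp add: n funpow_add)
  also have "\<dots> \<le> C * norm y"
    unfolding n_def using y(1) by (rule bdd)
  finally have "c ^ N * (r ^ N) ^ q0 \<le> C" using y(2) by simp
  then show False using q0 c(1) by (simp add: field_simps)
qed

section \<open>Basic sequences\<close>

text \<open>Normalized basic sequences whose partial sum projections have norm at most \<open>2\<close>, expressed
  through finite linear combinations.\<close>

definition basic :: "(nat \<Rightarrow> 'a::complex_banach) \<Rightarrow> bool" where
  "basic e \<longleftrightarrow> (\<forall>j. norm (e j) = 1) \<and>
     (\<forall>a n m. n \<le> m \<longrightarrow> norm (\<Sum>j<n. a j *\<^sub>C e j) \<le> 2 * norm (\<Sum>j<m. a j *\<^sub>C e j))"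

lemma coefficient_bound:
  fixes n :: nat
  assumes "\<And>k. k \<le> n \<Longrightarrow> norm (\<Sum>j<k. a j *\<^sub>C e j) \<le> 2 * norm (\<Sum>j<n. a j *\<^sub>C e j)"
    and "norm (e j) = 1" "j < n"
  shows "cmod (a j) \<le> 4 * norm (\<Sum>j<n. a j *\<^sub>C e j)"
proof -
  have "cmod (a j) = norm ((\<Sum>i<Suc j. a i *\<^sub>C e i) - (\<Sum>i<j. a i *\<^sub>C e i))"
    using assms(2) by (simp add: norm_scaleC)
  also have "\<dots> \<le> norm (\<Sum>i<Suc j. a i *\<^sub>C e i) + norm (\<Sum>i<j. a i *\<^sub>C e i)"
    by (rule norm_triangle_ineq4)
  finally show ?thesis
    using assms(1)[of "Suc j"] assms(1)[of j] assms(3) by linarith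
qed

lemma basic_coefficient_bound:
  "basic e \<Longrightarrow> j < n \<Longrightarrow> cmod (a j) \<le> 4 * norm (\<Sum>j<n. a j *\<^sub>C e j)"
  by (rule coefficient_bound) (auto simp: basic_def)

lemma basic_subsequence:
  assumes "basic e" "strict_mono k"
  shows "basic (\<lambda>j. e (k j))"
proof -
  have "norm (\<Sum>j<n. a j *\<^sub>C e (k j)) \<le> 2 * norm (\<Sum>j<m. a j *\<^sub>C e (k j))" if "n \<le> m" for a n m
  proof -
    define a' where "a' i = (if i \<in> range k then a (inv k i) else 0)" for i
    have inj: "inj k" using assms(2) by (rule strict_mono_imp_inj_on)
    have a'k: "a' (k j) = a j" for j
      using inj by (simp add: a'_def)
    have sum: "(\<Sum>i<k n. a' i *\<^sub>C e i) = (\<Sum>j<n. a j *\<^sub>C e (k j))" for n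
    proof -
      have "(\<Sum>i\<in>k ` {..<n}. a' i *\<^sub>C e i) = (\<Sum>i<k n. a' i *\<^sub>C e i)"
      proof (rule sum.mono_neutral_left)
        show "k ` {..<n} \<subseteq> {..<k n}"
          using assms(2) by (auto dest: strict_monoD)
        show "\<forall>i\<in>{..<k n} - k ` {..<n}. a' i *\<^sub>C e i = 0"
          using assms(2) by (auto simp: a'_def strict_mono_less)
      qed simp
      then show ?thesis
        by (simp add: sum.reindex[OF inj_on_subset[OF inj subset_UNIV]] a'k)
    qed
    have "k n \<le> k m" using assms(2) that by (simp add: strict_mono_less_eq)
    then have "norm (\<Sum>i<k n. a' i *\<^sub>C e i) \<le> 2 * norm (\<Sum>i<k m. a' i *\<^sub>C e i)"
      using assms(1) by (auto simp: basic_def)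
    then show ?thesis by (simp add: sum)
  qed
  then show ?thesis using assms(1) by (auto simp: basic_def)
qed

lemma compact_bounded_combinations:
  fixes n :: nat
  shows "compact {\<Sum>j<n. a j *\<^sub>C e j | a. \<forall>j<n. cmod (a j) \<le> C}"
proof (induction n)
  case 0
  then show ?case by simp
next
  case (Suc n)
  let ?K = "{\<Sum>j<n. a j *\<^sub>C e j | a. \<forall>j<n. cmod (a j) \<le> C}"
  have "compact ((\<lambda>c. c *\<^sub>C e n) ` cball 0 C)"
    by (intro compact_continuous_image scaleC.continuous_on continuous_intros compact_cball)
  then have "compact {x + y | x y. x \<in> ?K \<and> y \<in> (\<lambda>c. c *\<^sub>C e n) ` cball 0 C}"
    using Suc compact_sums by blast
  also have "{x + y | x y. x \<in> ?K \<and> y \<in> (\<lambda>c. c *\<^sub>C e n) ` cball 0 C}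
      = {\<Sum>j<Suc n. a j *\<^sub>C e j | a. \<forall>j<Suc n. cmod (a j) \<le> C}" (is "?L = ?R")
  proof
    show "?R \<subseteq> ?L"
      by (fastforce simp: less_Suc_eq)
    show "?L \<subseteq> ?R"
    proof
      fix v assume "v \<in> ?L"
      then obtain a c where v: "v = (\<Sum>j<n. a j *\<^sub>C e j) + c *\<^sub>C e n"
        "\<forall>j<n. cmod (a j) \<le> C" "cmod c \<le> C"
        by auto
      have "v = (\<Sum>j<Suc n. (a(n := c)) j *\<^sub>C e j)"
        using v(1) by simp
      moreover have "\<forall>j<Suc n. cmod ((a(n := c)) j) \<le> C"
        using v by (simp add: less_Suc_eq)
      ultimately show "v \<in> ?R" by blast
    qed
  qed
  finally show ?case .
qed

lemma basic_sequence_exists: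
  fixes S :: "'a::complex_banach \<Rightarrow> 'a"
  assumes S: "clinear S"
    and freq: "\<And>c. c > 0 \<Longrightarrow> \<exists>\<^sub>F y in cofin. norm (S y) < c * norm y"
  shows "\<exists>e. basic e \<and> (\<forall>n. norm (S (e n)) \<le> (1 / 2) ^ n)"
proof -
  \<comment> \<open>The bounds \<open>b n / b (Suc n) < 1\<close> for the successive projections have products above \<open>1 / 2\<close>.\<close>
  define b :: "nat \<Rightarrow> real" where "b n = 2 - (1 / 2) ^ n" for n
  have b: "1 \<le> b n" "b n < 2" "b n < b (Suc n)" for n
    by (auto simp: b_def power_le_one)
  define P where "P f n r \<longleftrightarrow> norm r = 1 \<and> norm (S r) \<le> (1 / 2) ^ n \<and>
      (\<forall>a c. b n * norm (\<Sum>j<n. a j *\<^sub>C f j) \<le> b (Suc n) * norm ((\<Sum>j<n. a j *\<^sub>C f j) + c *\<^sub>C r))"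
    for f :: "nat \<Rightarrow> 'a" and n r
  have proj: "norm (\<Sum>j<n. a j *\<^sub>C f j) \<le> 2 * norm (\<Sum>j<m. a j *\<^sub>C f j)"
    if "\<And>j. j < m \<Longrightarrow> P f j (f j)" "n \<le> m" for f a n m
  proof -
    have "b n * norm (\<Sum>j<n. a j *\<^sub>C f j) \<le> b m * norm (\<Sum>j<m. a j *\<^sub>C f j)"
      using that(2,1)
    proof (induction m rule: dec_induct)
      case (step m)
      have "b n * norm (\<Sum>j<n. a j *\<^sub>C f j) \<le> b m * norm (\<Sum>j<m. a j *\<^sub>C f j)"
        using step by simp
      also have "\<dots> \<le> b (Suc m) * norm (\<Sum>j<Suc m. a j *\<^sub>C f j)"
        using step.prems[of m] unfolding P_def sum.lessThan_Suc by blast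
      finally show ?case .
    qed simp
    also have "\<dots> \<le> 2 * norm (\<Sum>j<m. a j *\<^sub>C f j)"
      using b(2)[of m] by (intro mult_right_mono) auto
    finally show ?thesis
      using mult_right_mono[OF b(1)[of n], of "norm (\<Sum>j<n. a j *\<^sub>C f j)"] by simp
  qed
  have "\<exists>f. \<forall>n. P f n (f n)"
  proof (rule dependent_wf_choice[of "{(x, y). x < y}" P])
    show "wf {(x, y). x < (y :: nat)}" by (rule wf)
    show "P f n r = P g n r" if "\<And>z. (z, n) \<in> {(x, y). x < y} \<Longrightarrow> f z = g z" for f g n r
    proof -
      have "(\<Sum>j<n. a j *\<^sub>C f j) = (\<Sum>j<n. a j *\<^sub>C g j)" for a
        using that by (intro sum.cong) auto
      then show ?thesis by (simp add: P_def)
    qed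
    fix n f
    assume "\<And>y. (y, n) \<in> {(x, y). x < y} \<Longrightarrow> P f y (f y)"
    then have IH: "\<And>j. j < n \<Longrightarrow> P f j (f j)" by simp
    \<comment> \<open>By the coefficient bound, \<open>K\<close> contains the unit ball of the span of the vectors chosen so far.\<close>
    define K where "K = {\<Sum>j<n. a j *\<^sub>C f j | a. \<forall>j<n. cmod (a j) \<le> 4}"
    define \<epsilon> where "\<epsilon> = 1 - b n / b (Suc n)"
    have \<epsilon>: "\<epsilon> > 0" using b[of n] by (simp add: \<epsilon>_def)
    have "compact K" unfolding K_def by (rule compact_bounded_combinations)
    then have "\<forall>\<^sub>F x in cofin. \<forall>c. \<forall>g\<in>K. norm g \<le> norm (g + c *\<^sub>C x) + \<epsilon>"
      using \<epsilon> by (intro eventually_cofin_scale eventually_cofin_compact)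
    moreover have "\<exists>\<^sub>F y in cofin. norm (S y) < (1 / 2) ^ n * norm y"
      by (intro freq) simp
    ultimately have "\<exists>\<^sub>F y in cofin. (\<forall>c. \<forall>g\<in>K. norm g \<le> norm (g + c *\<^sub>C y) + \<epsilon>) \<and>
        norm (S y) < (1 / 2) ^ n * norm y"
      by (rule frequently_eventually_conj[rotated])
    then obtain y where y: "norm (S y) < (1 / 2) ^ n * norm y"
      "\<And>c g. g \<in> K \<Longrightarrow> norm g \<le> norm (g + c *\<^sub>C y) + \<epsilon>"
      by (auto dest: frequently_ex)
    have y0: "norm y > 0" using y(1) by (auto simp: clinear_zero[OF S])
    define r where "r = (1 / norm y) *\<^sub>R y"
    have "P f n r"
      unfolding P_def
    proof (intro conjI allI)
      show "norm r = 1" using y0 by (simp add: r_def)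
      show "norm (S r) \<le> (1 / 2) ^ n"
        using y0 y(1) by (simp add: r_def clinear_scaleR[OF S] field_simps)
      fix a c
      define g where "g = (\<Sum>j<n. a j *\<^sub>C f j)"
      show "b n * norm (\<Sum>j<n. a j *\<^sub>C f j) \<le> b (Suc n) * norm ((\<Sum>j<n. a j *\<^sub>C f j) + c *\<^sub>C r)"
      proof (cases "g = 0")
        case True
        then show ?thesis using b(1)[of "Suc n"] by (simp add: g_def[symmetric])
      next
        case False
        then have g0: "norm g > 0" by simp
        have "cmod (a j) \<le> 4 * norm g" if "j < n" for j
          unfolding g_def using IH that
          by (intro coefficient_bound proj) (auto simp: P_def)
        then have le4: "\<forall>j<n. cmod (of_real (1 / norm g) * a j) \<le> 4"
          using g0 by (simp add: norm_mult norm_divide field_simps)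
        have scaled: "t *\<^sub>R g = (\<Sum>j<n. (of_real t * a j) *\<^sub>C f j)" for t :: real
          by (simp only: g_def scaleC.sum_right scaleC_scaleC flip: scaleC_of_real)
        have "(1 / norm g) *\<^sub>R g \<in> K"
          unfolding K_def using le4 scaled[of "1 / norm g"]
          by (intro CollectI exI[of _ "\<lambda>j. of_real (1 / norm g) * a j"] conjI)
        then have "norm ((1 / norm g) *\<^sub>R g) \<le>
            norm ((1 / norm g) *\<^sub>R g + (of_real (1 / norm g) * (c * of_real (1 / norm y))) *\<^sub>C y) + \<epsilon>"
          by (rule y(2))
        also have "(1 / norm g) *\<^sub>R g + (of_real (1 / norm g) * (c * of_real (1 / norm y))) *\<^sub>C y
            = (1 / norm g) *\<^sub>R (g + c *\<^sub>C r)"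
          unfolding scaleC_scaleC[symmetric] scaleC_of_real r_def by (simp add: scaleR_add_right)
        finally have "1 \<le> norm (g + c *\<^sub>C r) / norm g + \<epsilon>" using g0 by simp
        then have "b n / b (Suc n) * norm g \<le> norm (g + c *\<^sub>C r)"
          using g0 by (simp add: \<epsilon>_def field_simps)
        then show ?thesis
          using b(1)[of "Suc n"] by (simp add: g_def[symmetric] field_simps)
      qed
    qed
    then show "\<exists>r. P f n r" by blast
  qed
  then obtain e where e: "\<And>n. P e n (e n)" by blast
  have "basic e"
    unfolding basic_def using proj[of _ e] e by (auto simp: P_def)
  moreover have "norm (S (e n)) \<le> (1 / 2) ^ n" for n
    using e by (simp add: P_def)
  ultimately show ?thesis by blast
qed

lemma basic_perturbation:
  assumes e: "basic e" and z: "\<And>j. norm (z j - e j) \<le> (1 / 2) ^ j / 16"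
  shows "norm ((\<Sum>j<n. a j *\<^sub>C z j) - (\<Sum>j<n. a j *\<^sub>C e j)) \<le> norm (\<Sum>j<n. a j *\<^sub>C e j) / 2"
proof -
  define u where "u = (\<Sum>j<n. a j *\<^sub>C e j)"
  have "(\<Sum>j<n. a j *\<^sub>C z j) - u = (\<Sum>j<n. a j *\<^sub>C (z j - e j))"
    by (simp add: u_def scaleC.diff_right sum_subtractf)
  also have "norm \<dots> \<le> (\<Sum>j<n. (4 * norm u) * ((1 / 2) ^ j / 16))"
  proof (rule sum_norm_le)
    fix j assume "j \<in> {..<n}"
    then have "cmod (a j) \<le> 4 * norm u"
      unfolding u_def using e by (intro basic_coefficient_bound) auto
    then show "norm (a j *\<^sub>C (z j - e j)) \<le> (4 * norm u) * ((1 / 2) ^ j / 16)"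
      unfolding norm_scaleC using z by (intro mult_mono) auto
  qed
  also have "\<dots> = norm u / 4 * (\<Sum>j<n. (1 / 2) ^ j)"
    by (simp add: sum_distrib_left)
  also have "\<dots> \<le> norm u / 4 * 2"
    by (intro mult_left_mono) (simp_all add: sum_gp_strict)
  finally show ?thesis by (simp add: u_def)
qed

section \<open>Simultaneous approximation along one sequence\<close>

lemma coordinatewise_funpow:
  "j < n \<Longrightarrow> (coordinatewise n (\<lambda>_. T) ^^ m) x j = (T ^^ m) (x j)"
  by (induction m) (simp_all add: coordinatewise_def)

text \<open>The only form in which the approximation hypothesis is used: each finite tuple of vectors can be
  perturbed so that one power of \<open>T\<close>, of exponent as large as desired, is close to all the prescribed
  operators.\<close>

lemma simultaneously_approximatedD:
  fixes T :: "'a::complex_banach \<Rightarrow> 'a" and f :: "nat \<Rightarrow> 'a \<Rightarrow> 'a" and n :: nat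
  assumes "simultaneously_approximated H T" "\<And>j. j < n \<Longrightarrow> f j \<in> H" "n \<ge> 1" "\<delta> > 0"
  shows "\<exists>z m. m > m0 \<and>
    (\<forall>j<n. norm (z j - y j) < \<delta> \<and> norm ((T ^^ m) (z j) - f j (z j)) < \<delta>)"
proof -
  let ?Y = "power_top n :: (nat \<Rightarrow> 'a) topology"
  let ?S = "coordinatewise n (\<lambda>_. T)"
  let ?D = "{x \<in> topspace ?Y. \<exists>\<omega>. pos_strict_seq \<omega> \<and>
      limitin ?Y (\<lambda>k. (?S ^^ \<omega> k) x) (coordinatewise n f x) sequentially}"
  have dense: "?Y closure_of ?D = topspace ?Y"
    using assms unfolding simultaneously_approximated_def Sigma_set_def by blast
  define U where "U = (\<Pi>\<^sub>E j\<in>{..<n}. ball (y j) \<delta>)"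
  have "openin ?Y U"
    unfolding U_def power_top_def by (simp add: openin_PiE)
  moreover have "restrict y {..<n} \<in> U"
    using assms(4) by (auto simp: U_def)
  moreover have "restrict y {..<n} \<in> topspace ?Y"
    by (auto simp: power_top_def)
  ultimately have "\<exists>z. z \<in> ?D \<and> z \<in> U"
    using dense in_closure_of[of "restrict y {..<n}" ?Y ?D] by blast
  then obtain z where z: "z \<in> ?D" "z \<in> U" by blast
  then obtain \<omega> where \<omega>: "pos_strict_seq \<omega>"
    "limitin ?Y (\<lambda>k. (?S ^^ \<omega> k) z) (coordinatewise n f z) sequentially"
    by blast
  have "(\<lambda>k. (T ^^ \<omega> k) (z j)) \<longlonglongrightarrow> f j (z j)" if "j < n" for j
  proof -
    have "limitin euclidean (\<lambda>k. (?S ^^ \<omega> k) z j) (coordinatewise n f z j) sequentially"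
      using \<omega>(2) that unfolding power_top_def by (auto simp: limitin_componentwise)
    then show ?thesis
      using that by (simp add: coordinatewise_funpow) (simp add: coordinatewise_def)
  qed
  then have "\<forall>\<^sub>F k in sequentially. norm ((T ^^ \<omega> k) (z j) - f j (z j)) < \<delta>" if "j < n" for j
    using tendstoD[OF _ assms(4)] that by (force simp: dist_norm)
  then have "\<forall>\<^sub>F k in sequentially. \<forall>j\<in>{..<n}. norm ((T ^^ \<omega> k) (z j) - f j (z j)) < \<delta>"
    by (simp add: eventually_ball_finite)
  moreover have "\<forall>\<^sub>F k in sequentially. \<omega> k > m0"
    using \<omega>(1) strict_mono_imp_increasing[of \<omega>] unfolding pos_strict_seq_def
    by (intro eventually_sequentiallyI[of "Suc m0"]) (meson Suc_le_lessD le_trans)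
  ultimately have "\<forall>\<^sub>F k in sequentially. \<omega> k > m0 \<and>
      (\<forall>j\<in>{..<n}. norm ((T ^^ \<omega> k) (z j) - f j (z j)) < \<delta>)"
    by (simp add: eventually_conj_iff)
  then have "\<exists>k. \<omega> k > m0 \<and> (\<forall>j\<in>{..<n}. norm ((T ^^ \<omega> k) (z j) - f j (z j)) < \<delta>)"
    by (rule eventually_happens'[OF sequentially_bot])
  then obtain k where k: "\<omega> k > m0" "\<forall>j\<in>{..<n}. norm ((T ^^ \<omega> k) (z j) - f j (z j)) < \<delta>"
    by (elim exE conjE)
  moreover have "norm (z j - y j) < \<delta>" if "j < n" for j
  proof -
    have "z j \<in> ball (y j) \<delta>"
      using z(2) that unfolding U_def by (intro PiE_mem[of z]) auto
    then show ?thesis by (simp add: dist_norm norm_minus_commute)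
  qed
  ultimately show ?thesis
    by (intro exI[of _ z] exI[of _ "\<omega> k"]) simp
qed

lemma shift_powers_tendsto:
  assumes T: "clinear T" and L: "\<And>x. norm (T x) \<le> L * norm x"
    and e: "\<And>n. norm (shift T \<mu> (e n)) \<le> (1 / 2) ^ n"
  shows "(\<lambda>k. (T ^^ m) (e k) - \<mu> ^ m *\<^sub>C e k) \<longlonglongrightarrow> 0"
proof (induction m)
  case (Suc m)
  have e0: "(\<lambda>k. shift T \<mu> (e k)) \<longlonglongrightarrow> 0"
    by (rule Lim_null_comparison[where g = "\<lambda>n. (1 / 2) ^ n"])
      (use e in \<open>auto intro!: LIMSEQ_power_zero\<close>)
  have "bounded_linear T"
    using clinear_imp_linear[OF T] L
    by (intro bounded_linear_intro[of T L]) (auto simp: linear_add linear_cmul mult.commute)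
  from bounded_linear.tendsto[OF this Suc]
  have "(\<lambda>k. T ((T ^^ m) (e k) - \<mu> ^ m *\<^sub>C e k) + \<mu> ^ m *\<^sub>C shift T \<mu> (e k)) \<longlonglongrightarrow> T 0 + \<mu> ^ m *\<^sub>C 0"
    by (intro tendsto_add scaleC.tendsto tendsto_const e0)
  then show ?case
    by (simp add: clinear_zero[OF T] clinear_diff[OF T] clinear_scale[OF T] shift_def
        scaleC.diff_right scaleC_scaleC mult.commute)
qed simp

text \<open>The inductive construction. At stage \<open>n\<close> the vectors \<open>z n j\<close> with \<open>j \<le> n\<close> are in use. The factor
  \<open>L ^ \<theta> n\<close> in front of the perturbations made at stage \<open>Suc n\<close> dominates the norms of the powers of
  \<open>T\<close> chosen earlier, so these perturbations preserve what was achieved before.\<close>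

lemma approximating_sequences:
  fixes T :: "'a::complex_banach \<Rightarrow> 'a" and f :: "nat \<Rightarrow> 'a \<Rightarrow> 'a"
  assumes T: "clinear T" and L: "\<And>x. norm (T x) \<le> L * norm x" "L \<ge> 1"
    and sim: "simultaneously_approximated H T" "\<And>j. f j \<in> H"
    and e: "basic e" "\<And>n. norm (shift T \<mu> (e n)) \<le> (1 / 2) ^ n"
  shows "\<exists>k \<theta> z. strict_mono k \<and> pos_strict_seq \<theta> \<and>
    norm (z 0 0 - e (k 0)) \<le> 1 / 32 \<and>
    (\<forall>n. \<forall>j\<le>n. norm ((T ^^ \<theta> n) (z n j) - f j (z n j)) \<le> (1 / 2) ^ n) \<and>
    (\<forall>n. \<forall>m\<le>\<theta> n. norm ((T ^^ m) (e (k (Suc n))) - \<mu> ^ m *\<^sub>C e (k (Suc n))) \<le> (1 / 2) ^ Suc n) \<and>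
    (\<forall>n. \<forall>j\<le>Suc n. L ^ \<theta> n * norm (z (Suc n) j - (if j \<le> n then z n j else e (k (Suc n))))
        \<le> (1 / 2) ^ Suc n / 32)"
proof -
  define P where "P = (\<lambda>n (k, \<theta>, z). 0 < \<theta> \<and> (n = 0 \<longrightarrow> norm (z 0 - e k) \<le> 1 / 32) \<and>
    (\<forall>j\<le>n. norm ((T ^^ \<theta>) (z j) - f j (z j)) \<le> (1 / 2) ^ n))"
  define Q where "Q = (\<lambda>n (k, \<theta>, z) (k', \<theta>', z'). k < k' \<and> \<theta> < \<theta>' \<and>
    (\<forall>m\<le>\<theta>. norm ((T ^^ m) (e k') - \<mu> ^ m *\<^sub>C e k') \<le> (1 / 2) ^ Suc n) \<and>
    (\<forall>j\<le>Suc n. L ^ \<theta> * norm (z' j - (if j \<le> n then z j else e k')) \<le> (1 / 2) ^ Suc n / 32))"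
  have "\<exists>s. \<forall>n. P n (s n) \<and> Q n (s n) (s (Suc n))"
  proof (rule dependent_nat_choice)
    obtain z :: "nat \<Rightarrow> 'a" and m where "m > 0" "norm (z 0 - e 0) < 1 / 32" "norm ((T ^^ m) (z 0) - f 0 (z 0)) < 1 / 32"
      using simultaneously_approximatedD[OF sim(1), of 1 f "1 / 32" 0 "\<lambda>_. e 0"] sim(2) by auto
    then show "\<exists>s. P 0 s"
      unfolding P_def by (intro exI[of _ "(0 :: nat, m, z)"]) auto
  next
    fix s n assume "P n s"
    obtain k \<theta> z where s: "s = (k, \<theta>, z)" by (cases s)
    have "\<forall>\<^sub>F i in sequentially. norm ((T ^^ m) (e i) - \<mu> ^ m *\<^sub>C e i) < (1 / 2) ^ Suc n" for m
      using tendstoD[OF shift_powers_tendsto[OF T L(1) e(2)], of "(1 / 2) ^ Suc n" m]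
      by (simp add: dist_norm)
    then have "\<forall>\<^sub>F i in sequentially. \<forall>m\<in>{..\<theta>}. norm ((T ^^ m) (e i) - \<mu> ^ m *\<^sub>C e i) < (1 / 2) ^ Suc n"
      by (simp add: eventually_ball_finite)
    then obtain k0 where k0: "\<And>i m. i \<ge> k0 \<Longrightarrow> m \<le> \<theta> \<Longrightarrow>
        norm ((T ^^ m) (e i) - \<mu> ^ m *\<^sub>C e i) < (1 / 2) ^ Suc n"
      by (auto simp: eventually_sequentially)
    define k' where "k' = max k0 (Suc k)"
    define \<delta> where "\<delta> = (1 / 2) ^ Suc n / 32 / L ^ \<theta>"
    have L\<theta>: "L ^ \<theta> \<ge> 1" using L(2) by simp
    have \<delta>: "\<delta> > 0" using L\<theta> by (simp add: \<delta>_def)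
    have "(1 / 2) ^ Suc n / (32::real) / L ^ \<theta> \<le> (1 / 2) ^ Suc n / 1 / 1"
      using L\<theta> by (intro frac_le) auto
    then have \<delta>': "\<delta> \<le> (1 / 2) ^ Suc n" by (simp add: \<delta>_def)
    obtain z' \<theta>' where z': "\<theta>' > \<theta>"
      "\<And>j. j < Suc (Suc n) \<Longrightarrow> norm (z' j - (if j \<le> n then z j else e k')) < \<delta>"
      "\<And>j. j < Suc (Suc n) \<Longrightarrow> norm ((T ^^ \<theta>') (z' j) - f j (z' j)) < \<delta>"
      using simultaneously_approximatedD[OF sim(1), of "Suc (Suc n)" f \<delta> \<theta>
          "\<lambda>j. if j \<le> n then z j else e k'"] sim(2) \<delta> by auto
    have "norm ((T ^^ \<theta>') (z' j) - f j (z' j)) \<le> (1 / 2) ^ Suc n" if "j \<le> Suc n" for j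
      using z'(3)[of j] \<delta>' that by simp
    then have "P (Suc n) (k', \<theta>', z')"
      unfolding P_def using z'(1) by auto
    moreover have "norm ((T ^^ m) (e k') - \<mu> ^ m *\<^sub>C e k') \<le> (1 / 2) ^ Suc n" if "m \<le> \<theta>" for m
      using k0[of k' m] that by (simp add: k'_def)
    moreover have "L ^ \<theta> * norm (z' j - (if j \<le> n then z j else e k')) \<le> (1 / 2) ^ Suc n / 32"
      if "j \<le> Suc n" for j
    proof -
      have "norm (z' j - (if j \<le> n then z j else e k')) \<le> \<delta>"
        using that by (intro less_imp_le z'(2)) simp
      then have "L ^ \<theta> * norm (z' j - (if j \<le> n then z j else e k')) \<le> L ^ \<theta> * \<delta>"
        using L\<theta> by (intro mult_left_mono) auto
      also have "\<dots> = (1 / 2) ^ Suc n / 32" using L(2) by (simp add: \<delta>_def)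
      finally show ?thesis .
    qed
    moreover have "k < k'" by (simp add: k'_def)
    ultimately have "P (Suc n) (k', \<theta>', z') \<and> Q n s (k', \<theta>', z')"
      using z'(1) unfolding Q_def s by blast
    then show "\<exists>s'. P (Suc n) s' \<and> Q n s s'" by blast
  qed
  then obtain s where s: "\<And>n. P n (s n)" "\<And>n. Q n (s n) (s (Suc n))" by blast
  define k \<theta> z where "k n = fst (s n)" and "\<theta> n = fst (snd (s n))" and "z n = snd (snd (s n))" for n
  have sn: "s n = (k n, \<theta> n, z n)" for n by (simp add: k_def \<theta>_def z_def)
  have P: "0 < \<theta> n" "n = 0 \<longrightarrow> norm (z n 0 - e (k n)) \<le> 1 / 32"
    "\<forall>j\<le>n. norm ((T ^^ \<theta> n) (z n j) - f j (z n j)) \<le> (1 / 2) ^ n" for n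
    using s(1)[of n] by (simp_all add: sn P_def)
  have Q: "k n < k (Suc n)" "\<theta> n < \<theta> (Suc n)"
    "\<forall>m\<le>\<theta> n. norm ((T ^^ m) (e (k (Suc n))) - \<mu> ^ m *\<^sub>C e (k (Suc n))) \<le> (1 / 2) ^ Suc n"
    "\<forall>j\<le>Suc n. L ^ \<theta> n * norm (z (Suc n) j - (if j \<le> n then z n j else e (k (Suc n))))
        \<le> (1 / 2) ^ Suc n / 32" for n
    using s(2)[of n] unfolding sn Q_def by blast+
  show ?thesis
    using P Q by (intro exI[of _ k] exI[of _ \<theta>] exI[of _ z])
      (auto simp: strict_mono_Suc_iff pos_strict_seq_def)
qed

text \<open>The properties of the limits \<open>z\<^sub>j\<close> of the vectors of the preceding lemma, and of the chosen
  subsequence \<open>e'\<close> of \<open>e\<close>.\<close>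

lemma perturbed_basic_sequence:
  fixes T :: "'a::complex_banach \<Rightarrow> 'a" and f :: "nat \<Rightarrow> 'a \<Rightarrow> 'a"
  assumes T: "clinear T" and L: "\<And>x. norm (T x) \<le> L * norm x" "L \<ge> 1"
    and sim: "simultaneously_approximated H T" "\<And>j. f j \<in> H"
    and f: "\<And>j. clinear (f j)" "\<And>j x. norm (f j x) \<le> \<Gamma> j * norm x" "\<And>j. \<Gamma> j \<ge> 0"
    and e: "basic e" "\<And>n. norm (shift T \<mu> (e n)) \<le> (1 / 2) ^ n"
  shows "\<exists>\<theta> e' z. pos_strict_seq \<theta> \<and> basic e' \<and>
    (\<forall>j. norm (z j - e' j) \<le> (1 / 2) ^ j / 16) \<and>
    (\<forall>n j. n < j \<longrightarrow> norm ((T ^^ \<theta> n) (z j) - \<mu> ^ \<theta> n *\<^sub>C e' j) \<le> 2 * (1 / 2) ^ j) \<and>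
    (\<forall>n j. j \<le> n \<longrightarrow> norm ((T ^^ \<theta> n) (z j) - f j (z j)) \<le> (2 + \<Gamma> j) * (1 / 2) ^ n)"
proof -
  obtain k \<theta> z where k: "strict_mono k" and \<theta>: "pos_strict_seq \<theta>"
    and z0: "norm (z 0 0 - e (k 0)) \<le> 1 / 32"
    and app': "\<forall>n. \<forall>j\<le>n. norm ((T ^^ \<theta> n) (z n j) - f j (z n j)) \<le> (1 / 2) ^ n"
    and near': "\<forall>n. \<forall>m\<le>\<theta> n.
        norm ((T ^^ m) (e (k (Suc n))) - \<mu> ^ m *\<^sub>C e (k (Suc n))) \<le> (1 / 2) ^ Suc n"
    and pert': "\<forall>n. \<forall>j\<le>Suc n.
        L ^ \<theta> n * norm (z (Suc n) j - (if j \<le> n then z n j else e (k (Suc n)))) \<le> (1 / 2) ^ Suc n / 32"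
    using approximating_sequences[OF T L sim(1), of f, OF sim(2) e] by (elim exE conjE) (rule that)
  note app = app'[rule_format] and near = near'[rule_format] and pert = pert'[rule_format]
  have mono: "\<theta> m \<le> \<theta> n" if "m \<le> n" for m n
    using \<theta> that by (simp add: pos_strict_seq_def strict_mono_less_eq)
  have Lmono: "L ^ \<theta> m \<le> L ^ \<theta> n" if "m \<le> n" for m n
    using mono[OF that] L(2) by (rule power_increasing)
  have L1: "L ^ m \<ge> 1" for m using L(2) by simp
  have later: "L ^ \<theta> n * norm (z N j - z n j) \<le> ((1 / 2) ^ n - (1 / 2) ^ N) / 32"
    if "n \<le> N" "j \<le> n" for n N j
    using that(1)
  proof (induction N rule: dec_induct)
    case (step N)
    have "L ^ \<theta> n * norm (z (Suc N) j - z N j) \<le> L ^ \<theta> N * norm (z (Suc N) j - z N j)"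
      using Lmono[of n N] step by (intro mult_right_mono) auto
    also have "\<dots> \<le> (1 / 2) ^ Suc N / 32"
      using pert[of j N] that(2) step(1) by simp
    finally have "L ^ \<theta> n * norm (z (Suc N) j - z N j) \<le> (1 / 2) ^ Suc N / 32" .
    moreover have "L ^ \<theta> n * norm (z (Suc N) j - z n j)
        \<le> L ^ \<theta> n * norm (z (Suc N) j - z N j) + L ^ \<theta> n * norm (z N j - z n j)"
      using norm_triangle_ineq[of "z (Suc N) j - z N j" "z N j - z n j"] L1[of "\<theta> n"]
      by (simp flip: distrib_left)
    moreover have "B \<le> (q - 1 / 2 * p) / 32"
      if "A \<le> 1 / 2 * p / 32" "B \<le> A + C" "C \<le> (q - p) / 32" for A B C p q :: real
      using that by simp
    ultimately show ?case using step.IH unfolding power_Suc by blast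
  qed simp
  have later': "norm (z N j - z n j) \<le> (1 / 2) ^ n / 32" if "n \<le> N" "j \<le> n" for n N j
  proof -
    have "norm (z N j - z n j) \<le> L ^ \<theta> n * norm (z N j - z n j)"
      using L1[of "\<theta> n"] by (simp add: mult_le_cancel_right1)
    also have "\<dots> \<le> ((1 / 2) ^ n - (1 / 2) ^ N) / 32"
      using that by (rule later)
    also have "\<dots> \<le> (1 / 2) ^ n / 32" by simp
    finally show ?thesis .
  qed
  have "Cauchy (\<lambda>n. z n j)" for j
  proof (rule metric_CauchyI)
    fix \<epsilon> :: real assume "\<epsilon> > 0"
    then obtain n0 where n0: "(1 / 2 :: real) ^ n0 < \<epsilon>"
      using real_arch_pow_inv[of \<epsilon> "1 / 2"] by auto
    define n where "n = max n0 j"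
    have "(1 / 2 :: real) ^ n \<le> (1 / 2) ^ n0"
      unfolding n_def by (intro power_decreasing) auto
    then have n: "(1 / 2 :: real) ^ n < \<epsilon>" using n0 by (rule le_less_trans)
    have "dist (z p j) (z q j) < \<epsilon>" if "p \<ge> n" "q \<ge> n" for p q
    proof -
      have "dist (z p j) (z q j) \<le> norm (z p j - z n j) + norm (z q j - z n j)"
        unfolding dist_norm using norm_triangle_ineq4[of "z p j - z n j" "z q j - z n j"] by simp
      also have "\<dots> \<le> (1 / 2) ^ n / 32 + (1 / 2) ^ n / 32"
        using that by (intro add_mono later') (auto simp: n_def)
      also have "\<dots> < \<epsilon>" using n \<open>\<epsilon> > 0\<close> by simp
      finally show ?thesis .
    qed
    then show "\<exists>M. \<forall>m\<ge>M. \<forall>n\<ge>M. dist (z m j) (z n j) < \<epsilon>" by blast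
  qed
  then obtain Z where Z: "\<And>j. (\<lambda>n. z n j) \<longlonglongrightarrow> Z j"
    unfolding Cauchy_convergent_iff convergent_def by metis
  have lim: "L ^ \<theta> n * norm (Z j - z n j) \<le> (1 / 2) ^ n / 32" if "j \<le> n" for n j
  proof (rule LIMSEQ_le_const2)
    show "(\<lambda>N. L ^ \<theta> n * norm (z N j - z n j)) \<longlonglongrightarrow> L ^ \<theta> n * norm (Z j - z n j)"
      by (intro tendsto_intros Z)
    have "L ^ \<theta> n * norm (z N j - z n j) \<le> (1 / 2) ^ n / 32" if "n \<le> N" for N
      using later[OF that \<open>j \<le> n\<close>] by (rule order_trans) simp
    then show "\<exists>N0. \<forall>N\<ge>N0. L ^ \<theta> n * norm (z N j - z n j) \<le> (1 / 2) ^ n / 32" by blast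
  qed
  have lim': "norm (Z j - z n j) \<le> (1 / 2) ^ n / 32" if "j \<le> n" for n j
  proof -
    have "norm (Z j - z n j) \<le> L ^ \<theta> n * norm (Z j - z n j)"
      using L1[of "\<theta> n"] by (simp add: mult_le_cancel_right1)
    then show ?thesis using lim[OF that] by linarith
  qed
  have start: "L ^ \<theta> n * norm (Z j - e (k j)) \<le> (1 / 2) ^ j / 16" if "n < j" for n j
  proof -
    obtain i where j: "j = Suc i" "n \<le> i" using \<open>n < j\<close> by (cases j) auto
    have "L ^ \<theta> n * norm (Z j - z j j) \<le> L ^ \<theta> j * norm (Z j - z j j)"
      using Lmono[of n j] that by (intro mult_right_mono) auto
    also have "\<dots> \<le> (1 / 2) ^ j / 32" by (rule lim) simp
    finally have "L ^ \<theta> n * norm (Z j - z j j) \<le> (1 / 2) ^ j / 32" .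
    moreover have "L ^ \<theta> n * norm (z j j - e (k j)) \<le> L ^ \<theta> i * norm (z j j - e (k j))"
      using Lmono[of n i] j by (intro mult_right_mono) auto
    moreover have "\<dots> \<le> (1 / 2) ^ j / 32"
      using pert[of j i] by (simp add: j)
    moreover have "L ^ \<theta> n * norm (Z j - e (k j))
        \<le> L ^ \<theta> n * norm (Z j - z j j) + L ^ \<theta> n * norm (z j j - e (k j))"
      using norm_triangle_ineq[of "Z j - z j j" "z j j - e (k j)"] L1[of "\<theta> n"]
      by (simp flip: distrib_left)
    ultimately show ?thesis by linarith
  qed
  have small: "norm (Z j - e (k j)) \<le> (1 / 2) ^ j / 16" for j
  proof (cases j)
    case 0
    show ?thesis
      using lim'[of 0 0] z0 norm_triangle_ineq[of "Z 0 - z 0 0" "z 0 0 - e (k 0)"] by (simp add: 0)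
  next
    case (Suc i)
    have "norm (Z j - e (k j)) \<le> L ^ \<theta> i * norm (Z j - e (k j))"
      using L1[of "\<theta> i"] by (simp add: mult_le_cancel_right1)
    then show ?thesis using start[of i j] Suc by simp
  qed
  have far: "norm ((T ^^ \<theta> n) (Z j) - \<mu> ^ \<theta> n *\<^sub>C e (k j)) \<le> 2 * (1 / 2) ^ j" if "n < j" for n j
  proof -
    obtain i where j: "j = Suc i" "n \<le> i" using \<open>n < j\<close> by (cases j) auto
    have "norm ((T ^^ \<theta> n) (Z j - e (k j))) \<le> L ^ \<theta> n * norm (Z j - e (k j))"
      using L by (intro norm_funpow_le) auto
    also have "\<dots> \<le> (1 / 2) ^ j / 16" using that by (rule start)
    finally have 1: "norm ((T ^^ \<theta> n) (Z j - e (k j))) \<le> (1 / 2) ^ j"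
      by (rule order_trans) simp
    have 2: "norm ((T ^^ \<theta> n) (e (k j)) - \<mu> ^ \<theta> n *\<^sub>C e (k j)) \<le> (1 / 2) ^ j"
      using near[OF mono[OF j(2)]] by (simp add: j(1))
    have eq: "(T ^^ \<theta> n) (Z j) - \<mu> ^ \<theta> n *\<^sub>C e (k j)
        = (T ^^ \<theta> n) (Z j - e (k j)) + ((T ^^ \<theta> n) (e (k j)) - \<mu> ^ \<theta> n *\<^sub>C e (k j))"
      by (simp add: clinear_diff[OF clinear_funpow[OF T]])
    show ?thesis
      unfolding eq by (rule order_trans[OF norm_triangle_ineq]) (use 1 2 in simp)
  qed
  have approx: "norm ((T ^^ \<theta> n) (Z j) - f j (Z j)) \<le> (2 + \<Gamma> j) * (1 / 2) ^ n" if "j \<le> n" for n j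
  proof -
    have "norm ((T ^^ \<theta> n) (Z j - z n j)) \<le> L ^ \<theta> n * norm (Z j - z n j)"
      using L by (intro norm_funpow_le) auto
    also have "\<dots> \<le> (1 / 2) ^ n / 32" using that by (rule lim)
    finally have 1: "norm ((T ^^ \<theta> n) (Z j - z n j)) \<le> (1 / 2) ^ n"
      by (rule order_trans) simp
    have "norm (f j (Z j - z n j)) \<le> \<Gamma> j * norm (Z j - z n j)" by (rule f(2))
    also have "\<dots> \<le> \<Gamma> j * ((1 / 2) ^ n / 32)"
      using lim'[OF that] f(3) by (intro mult_left_mono)
    also have "\<dots> \<le> \<Gamma> j * (1 / 2) ^ n"
      using f(3) by (intro mult_left_mono) auto
    finally have 2: "norm (f j (Z j - z n j)) \<le> \<Gamma> j * (1 / 2) ^ n" .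
    have "(T ^^ \<theta> n) (Z j) - f j (Z j)
        = ((T ^^ \<theta> n) (Z j - z n j) + ((T ^^ \<theta> n) (z n j) - f j (z n j))) - f j (Z j - z n j)"
      by (simp add: clinear_diff[OF clinear_funpow[OF T]] clinear_diff[OF f(1)])
    then have "norm ((T ^^ \<theta> n) (Z j) - f j (Z j)) \<le> norm ((T ^^ \<theta> n) (Z j - z n j))
        + norm ((T ^^ \<theta> n) (z n j) - f j (z n j)) + norm (f j (Z j - z n j))"
      by (smt (verit) norm_triangle_ineq norm_triangle_ineq4)
    then show ?thesis using 1 2 app[OF that] by (simp add: algebra_simps)
  qed
  show ?thesis
    using \<theta> basic_subsequence[OF e(1) k] small far approx
    by (intro exI[of _ \<theta>] exI[of _ "\<lambda>j. e (k j)"] exI[of _ Z]) auto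
qed

section \<open>The subspaces\<close>

lemma cspan_combination:
  fixes z :: "nat \<Rightarrow> 'a::complex_banach"
  assumes "x \<in> cspan (z ` J)"
  shows "\<exists>a N. (\<forall>j. j \<notin> J \<or> N \<le> j \<longrightarrow> a j = 0) \<and> x = (\<Sum>j<N. a j *\<^sub>C z j)"
  using assms
proof (induction rule: complex_vector.span_induct_alt)
  case base
  show ?case by (intro exI[of _ "\<lambda>_. 0"] exI[of _ 0]) simp
next
  case (step c x y)
  then obtain a N i where a: "\<forall>j. j \<notin> J \<or> N \<le> j \<longrightarrow> a j = 0"
    and y: "y = (\<Sum>j<N. a j *\<^sub>C z j)" and i: "i \<in> J" "x = z i"
    by blast
  define a' where "a' = a(i := a i + c)"
  define M where "M = max N (Suc i)"
  have "y = (\<Sum>j<M. a j *\<^sub>C z j)"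
    unfolding y using a by (intro sum.mono_neutral_left) (auto simp: M_def)
  moreover have "c *\<^sub>C x = (\<Sum>j<M. (if j = i then c else 0) *\<^sub>C z j)"
  proof -
    have "(\<Sum>j<M. (if j = i then c else 0) *\<^sub>C z j) = (\<Sum>j<M. if j = i then c *\<^sub>C z j else 0)"
      by (intro sum.cong) auto
    moreover have "i < M" by (simp add: M_def)
    ultimately show ?thesis by (simp add: i)
  qed
  moreover have "(\<Sum>j<M. a' j *\<^sub>C z j)
      = (\<Sum>j<M. (if j = i then c else 0) *\<^sub>C z j) + (\<Sum>j<M. a j *\<^sub>C z j)"
    unfolding sum.distrib[symmetric] scaleC_add_left[symmetric]
    by (intro sum.cong) (auto simp: a'_def)
  ultimately have "c *\<^sub>C x + y = (\<Sum>j<M. a' j *\<^sub>C z j)" by simp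
  moreover have "\<forall>j. j \<notin> J \<or> M \<le> j \<longrightarrow> a' j = 0"
    using a i by (auto simp: a'_def M_def)
  ultimately show ?case by blast
qed

lemma csubspace_closure:
  assumes "csubspace S"
  shows "csubspace (closure S)"
  unfolding complex_vector.subspace_def
proof (intro conjI ballI allI)
  show "0 \<in> closure S"
    using assms closure_subset complex_vector.subspace_0 by blast
  fix x y assume "x \<in> closure S" "y \<in> closure S"
  then obtain f g where f: "\<And>n. f n \<in> S" "f \<longlonglongrightarrow> x" and g: "\<And>n. g n \<in> S" "g \<longlonglongrightarrow> y"
    unfolding closure_sequential by blast
  have "(\<lambda>n. f n + g n) \<longlonglongrightarrow> x + y" using f g by (intro tendsto_add)
  moreover have "f n + g n \<in> S" for n
    using f g assms by (simp add: complex_vector.subspace_add)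
  ultimately show "x + y \<in> closure S"
    unfolding closure_sequential by (intro exI[of _ "\<lambda>n. f n + g n"]) auto
next
  fix c x assume "x \<in> closure S"
  then obtain f where f: "\<And>n. f n \<in> S" "f \<longlonglongrightarrow> x"
    unfolding closure_sequential by blast
  have "(\<lambda>n. c *\<^sub>C f n) \<longlonglongrightarrow> c *\<^sub>C x" using f by (intro scaleC.tendsto tendsto_const)
  moreover have "c *\<^sub>C f n \<in> S" for n
    using f assms by (simp add: complex_vector.subspace_scale)
  ultimately show "c *\<^sub>C x \<in> closure S"
    unfolding closure_sequential by (intro exI[of _ "\<lambda>n. c *\<^sub>C f n"]) auto
qed

text \<open>The easy half of the Banach-Steinhaus theorem, on the closure of a set \<open>V\<close>.\<close>

lemma tendsto_on_closure:
  fixes S :: "nat \<Rightarrow> 'a::real_normed_vector \<Rightarrow> 'b::real_normed_vector"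
  assumes S: "\<And>n x y. S n (x - y) = S n x - S n y"
    and h: "\<And>x y. h (x - y) = h x - h y" "\<And>x. norm (h x) \<le> K * norm x"
    and bound: "\<And>n x. x \<in> closure V \<Longrightarrow> norm (S n x) \<le> K * norm x"
    and sub: "\<And>x y. x \<in> closure V \<Longrightarrow> y \<in> closure V \<Longrightarrow> x - y \<in> closure V"
    and lim: "\<And>x. x \<in> V \<Longrightarrow> (\<lambda>n. S n x) \<longlonglongrightarrow> h x"
    and x: "x \<in> closure V"
  shows "(\<lambda>n. S n x) \<longlonglongrightarrow> h x"
proof (rule tendstoI)
  fix \<epsilon> :: real assume \<epsilon>: "\<epsilon> > 0"
  define \<delta> where "\<delta> = \<epsilon> / 3 / (\<bar>K\<bar> + 1)"
  have K1: "\<bar>K\<bar> + 1 > 0" by simp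
  then have \<delta>: "\<delta> > 0" using \<epsilon> unfolding \<delta>_def by (intro divide_pos_pos) auto
  then obtain v where v: "v \<in> V" "norm (x - v) < \<delta>"
    using x unfolding closure_approachable dist_norm by (metis norm_minus_commute)
  have "v \<in> closure V" using v(1) closure_subset by blast
  then have xv: "x - v \<in> closure V" using x by (intro sub)
  have K: "K * norm (x - v) \<le> \<epsilon> / 3"
  proof -
    have "K * norm (x - v) \<le> (\<bar>K\<bar> + 1) * \<delta>"
      using v(2) by (intro mult_mono) auto
    also have "\<dots> = \<epsilon> / 3" using K1 unfolding \<delta>_def
      by (metis less_irrefl nonzero_mult_div_cancel_left times_divide_eq_right)
    finally show ?thesis .
  qed
  have "\<forall>\<^sub>F n in sequentially. dist (S n v) (h v) < \<epsilon> / 3"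
    using lim[OF v(1)] \<epsilon> by (intro tendstoD) auto
  then show "\<forall>\<^sub>F n in sequentially. dist (S n x) (h x) < \<epsilon>"
  proof eventually_elim
    case (elim n)
    have 1: "norm (S n (x - v)) \<le> \<epsilon> / 3" using bound[OF xv, of n] K by linarith
    have 2: "norm (h (x - v)) \<le> \<epsilon> / 3" using h(2)[of "x - v"] K by linarith
    have "S n x - h x = S n (x - v) + (S n v - h v) - h (x - v)"
      by (simp add: S h)
    then have "norm (S n x - h x) \<le> norm (S n (x - v)) + norm (S n v - h v) + norm (h (x - v))"
      by (smt (verit) norm_triangle_ineq norm_triangle_ineq4)
    then show ?case using 1 2 elim by (simp add: dist_norm)
  qed
qed

text \<open>A small perturbation of a basic sequence is linearly independent.\<close>

lemma infinite_dimensional_basic: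
  assumes e: "basic e" and pert: "\<And>j. norm (z j - e j) \<le> (1 / 2) ^ j / 16"
    and J: "infinite J" and V: "z ` J \<subseteq> V"
  shows "infinite_dimensional V"
proof -
  have zero: "a j = 0" if a: "(\<Sum>j<n. a j *\<^sub>C z j) = 0" and "j < n" for a and n j :: nat
  proof -
    have "norm (\<Sum>j<n. a j *\<^sub>C e j) = 0"
      using basic_perturbation[OF e pert, where n = n and a = a] a by simp
    then show ?thesis
      using basic_coefficient_bound[OF e \<open>j < n\<close>, of a] by simp
  qed
  have inj: "inj z"
  proof (rule injI)
    fix i j assume eq: "z i = z j"
    show "i = j"
    proof (rule ccontr)
      assume "i \<noteq> j"
      define a :: "nat \<Rightarrow> complex" where "a = (\<lambda>_. 0)(i := 1, j := - 1)"
      define n where "n = Suc (max i j)"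
      have "(\<Sum>k<n. a k *\<^sub>C z k) = (\<Sum>k\<in>{i, j}. a k *\<^sub>C z k)"
        by (rule sum.mono_neutral_right) (auto simp: a_def n_def)
      also have "\<dots> = 0" using \<open>i \<noteq> j\<close> eq by (simp add: a_def)
      finally have "a i = 0" by (rule zero) (simp add: n_def)
      then show False using \<open>i \<noteq> j\<close> by (simp add: a_def)
    qed
  qed
  have "complex_vector.independent (z ` J)"
    unfolding complex_vector.independent_explicit_module
  proof (intro allI impI)
    fix t u v
    assume t: "finite t" "t \<subseteq> z ` J" "(\<Sum>v\<in>t. u v *\<^sub>C v) = 0" "v \<in> t"
    obtain A where A: "A \<subseteq> J" "t = z ` A" using t(2) by (auto simp: subset_image_iff)
    have "finite A" using t(1) A(2) inj by (simp add: finite_image_iff inj_on_subset)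
    then obtain n where n: "A \<subseteq> {..<n}" by (metis finite_nat_iff_bounded)
    define a where "a j = (if j \<in> A then u (z j) else 0)" for j
    have "(\<Sum>j<n. a j *\<^sub>C z j) = (\<Sum>j\<in>A. u (z j) *\<^sub>C z j)"
      using n by (intro sum.mono_neutral_cong_right) (auto simp: a_def)
    also have "\<dots> = 0"
      using t(3) inj unfolding A(2) by (simp add: sum.reindex inj_on_subset)
    finally have sum0: "(\<Sum>j<n. a j *\<^sub>C z j) = 0" .
    obtain j where j: "j \<in> A" "v = z j" using t(4) A(2) by blast
    then have "a j = 0" using n by (intro zero[OF sum0]) auto
    then show "u v = 0" using j by (simp add: a_def)
  qed
  moreover have "infinite (z ` J)"
    using J inj by (simp add: finite_image_iff inj_on_subset)
  ultimately show ?thesis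
    unfolding infinite_dimensional_def
    using V complex_vector.independent_span_bound by (metis subset_trans)
qed

text \<open>To be applied to the power \<open>S\<close> of \<open>T\<close> with exponent \<open>\<theta>\<^sub>n\<close>. It is essential that the bound does
  not depend on \<open>n\<close>. The hypothesis \<open>app\<close> carries a factor \<open>2\<^sup>-\<^sup>n\<close>, which absorbs the number \<open>n + 1\<close> of
  its instances.\<close>

lemma power_bound_on_span:
  fixes S h :: "'a::complex_banach \<Rightarrow> 'a"
  assumes S: "clinear S" and h: "clinear h" "\<And>x. norm (h x) \<le> \<Gamma> * norm x" "\<Gamma> \<ge> 0"
    and \<mu>: "cmod \<mu> \<le> 1"
    and e: "basic e" and pert: "\<And>j. norm (z j - e j) \<le> (1 / 2) ^ j / 16"
    and far: "\<And>j. n < j \<Longrightarrow> norm (S (z j) - \<mu> *\<^sub>C e j) \<le> 2 * (1 / 2) ^ j"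
    and app: "\<And>j. j \<in> J \<Longrightarrow> j \<le> n \<Longrightarrow> norm (S (z j) - h (z j)) \<le> (2 + \<Gamma>) * (1 / 2) ^ n"
    and x: "x \<in> cspan (z ` J)"
  shows "norm (S x) \<le> (54 + 14 * \<Gamma>) * norm x"
proof -
  obtain a N0 where a: "\<forall>j. j \<notin> J \<or> N0 \<le> j \<longrightarrow> a j = 0" and x0: "x = (\<Sum>j<N0. a j *\<^sub>C z j)"
    using cspan_combination[OF x] by blast
  define m where "m = Suc n"
  define N where "N = max m N0"
  have xN: "x = (\<Sum>j<N. a j *\<^sub>C z j)"
    unfolding x0 using a by (intro sum.mono_neutral_left) (auto simp: N_def)
  define u where "u = (\<Sum>j<N. a j *\<^sub>C e j)"
  define u1 where "u1 = (\<Sum>j<m. a j *\<^sub>C e j)"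
  define x1 where "x1 = (\<Sum>j<m. a j *\<^sub>C z j)"
  have mN: "m \<le> N" by (simp add: N_def)
  have split: "(\<Sum>j<N. F j) = (\<Sum>j<m. F j) + (\<Sum>j\<in>{m..<N}. F j)" for F :: "nat \<Rightarrow> 'a"
    using mN by (metis atLeast0LessThan le0 sum.atLeastLessThan_concat)
  have coeff: "cmod (a j) \<le> 4 * norm u" if "j < N" for j
    unfolding u_def using e that by (rule basic_coefficient_bound)
  have u1: "norm u1 \<le> 2 * norm u"
    using e mN unfolding u1_def u_def basic_def by blast
  have ux: "norm u \<le> 2 * norm x"
    using basic_perturbation[OF e pert, where n = N and a = a] norm_triangle_ineq4[of "x" "x - u"]
    by (simp add: xN[symmetric] u_def[symmetric])
  have x1: "norm x1 \<le> 3 * norm u"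
    using basic_perturbation[OF e pert, where n = m and a = a] norm_triangle_ineq[of u1 "x1 - u1"] u1
    by (simp add: x1_def[symmetric] u1_def[symmetric])
  have head: "norm (\<Sum>j<m. a j *\<^sub>C (S (z j) - h (z j))) \<le> 4 * norm u * (2 + \<Gamma>)"
  proof -
    have "norm (\<Sum>j<m. a j *\<^sub>C (S (z j) - h (z j))) \<le> (\<Sum>j<m. 4 * norm u * ((2 + \<Gamma>) * (1 / 2) ^ n))"
    proof (rule sum_norm_le)
      fix j assume j: "j \<in> {..<m}"
      show "norm (a j *\<^sub>C (S (z j) - h (z j))) \<le> 4 * norm u * ((2 + \<Gamma>) * (1 / 2) ^ n)"
      proof (cases "j \<in> J")
        case True
        then show ?thesis
          unfolding norm_scaleC using coeff[of j] app[of j] j mN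
          by (intro mult_mono) (auto simp: m_def)
      next
        case False
        then show ?thesis using a h(3) by simp
      qed
    qed
    also have "\<dots> = 4 * norm u * (2 + \<Gamma>) * (real m * (1 / 2) ^ n)"
      by simp
    also have "\<dots> \<le> 4 * norm u * (2 + \<Gamma>) * 1"
    proof (rule mult_left_mono)
      have "m \<le> 2 ^ n" unfolding m_def by (simp add: Suc_le_eq)
      then have "real m \<le> 2 ^ n" by (metis of_nat_le_iff of_nat_numeral of_nat_power)
      then show "real m * (1 / 2) ^ n \<le> 1" by (simp add: field_simps)
    qed (use h(3) in simp)
    finally show ?thesis by simp
  qed
  have tail: "norm (\<Sum>j\<in>{m..<N}. a j *\<^sub>C (S (z j) - \<mu> *\<^sub>C e j)) \<le> 16 * norm u"
  proof -
    have "norm (\<Sum>j\<in>{m..<N}. a j *\<^sub>C (S (z j) - \<mu> *\<^sub>C e j))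
        \<le> (\<Sum>j\<in>{m..<N}. 4 * norm u * (2 * (1 / 2) ^ j))"
    proof (rule sum_norm_le)
      fix j assume j: "j \<in> {m..<N}"
      then show "norm (a j *\<^sub>C (S (z j) - \<mu> *\<^sub>C e j)) \<le> 4 * norm u * (2 * (1 / 2) ^ j)"
        unfolding norm_scaleC using coeff[of j] far[of j]
        by (intro mult_mono) (auto simp: m_def)
    qed
    also have "\<dots> \<le> (\<Sum>j<N. 4 * norm u * (2 * (1 / 2) ^ j))"
      by (intro sum_mono2) auto
    also have "\<dots> = 8 * norm u * (\<Sum>j<N. (1 / 2) ^ j)"
      by (simp add: sum_distrib_left mult.assoc)
    also have "\<dots> \<le> 8 * norm u * 2"
      by (intro mult_left_mono) (simp_all add: sum_gp_strict)
    finally show ?thesis by simp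
  qed
  have "S x = (\<Sum>j<N. a j *\<^sub>C S (z j))"
    by (simp add: xN clinear_sum[OF S] clinear_scale[OF S])
  also have "\<dots> = (\<Sum>j<m. a j *\<^sub>C S (z j)) + (\<Sum>j\<in>{m..<N}. a j *\<^sub>C S (z j))"
    by (rule split)
  also have "(\<Sum>j<m. a j *\<^sub>C S (z j)) = h x1 + (\<Sum>j<m. a j *\<^sub>C (S (z j) - h (z j)))"
    by (simp add: x1_def clinear_sum[OF h(1)] clinear_scale[OF h(1)] scaleC.diff_right sum_subtractf)
  also have "(\<Sum>j\<in>{m..<N}. a j *\<^sub>C S (z j))
      = (\<Sum>j\<in>{m..<N}. a j *\<^sub>C (S (z j) - \<mu> *\<^sub>C e j)) + \<mu> *\<^sub>C (u - u1)"
    unfolding u_def u1_def split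
    by (simp add: scaleC.sum_right scaleC.diff_right sum_subtractf scaleC_scaleC mult.commute)
  finally have Sx: "S x = (h x1 + (\<Sum>j<m. a j *\<^sub>C (S (z j) - h (z j))))
      + ((\<Sum>j\<in>{m..<N}. a j *\<^sub>C (S (z j) - \<mu> *\<^sub>C e j)) + \<mu> *\<^sub>C (u - u1))" .
  have "norm (h x1) \<le> \<Gamma> * norm x1" by (rule h(2))
  also have "\<dots> \<le> \<Gamma> * (3 * norm u)" using x1 h(3) by (rule mult_left_mono)
  finally have hx1: "norm (h x1) \<le> 3 * (\<Gamma> * norm u)" by simp
  have "norm (\<mu> *\<^sub>C (u - u1)) \<le> 1 * norm (u - u1)"
    unfolding norm_scaleC using \<mu> by (intro mult_right_mono) auto
  also have "\<dots> \<le> 3 * norm u" using norm_triangle_ineq4[of u u1] u1 by simp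
  finally have \<mu>u: "norm (\<mu> *\<^sub>C (u - u1)) \<le> 3 * norm u" .
  have "norm (S x) \<le> (3 * (\<Gamma> * norm u) + 4 * norm u * (2 + \<Gamma>)) + (16 * norm u + 3 * norm u)"
    unfolding Sx by (intro norm_triangle_mono hx1 head tail \<mu>u)
  also have "\<dots> = (27 + 7 * \<Gamma>) * norm u"
    by (simp add: algebra_simps)
  also have "\<dots> \<le> (27 + 7 * \<Gamma>) * (2 * norm x)"
    using ux h(3) by (intro mult_left_mono) auto
  also have "\<dots> = (54 + 14 * \<Gamma>) * norm x"
    by (simp add: algebra_simps)
  finally show ?thesis .
qed

lemma convergence_on_closed_span:
  fixes T h :: "'a::complex_banach \<Rightarrow> 'a"
  assumes T: "clinear T" "\<And>x. norm (T x) \<le> L * norm x" "L \<ge> 0"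
    and h: "clinear h" "\<And>x. norm (h x) \<le> \<Gamma> * norm x" "\<Gamma> \<ge> 0"
    and \<mu>: "cmod \<mu> \<le> 1"
    and e: "basic e" and pert: "\<And>j. norm (z j - e j) \<le> (1 / 2) ^ j / 16"
    and far: "\<And>n j. n < j \<Longrightarrow> norm ((T ^^ \<theta> n) (z j) - \<mu> ^ \<theta> n *\<^sub>C e j) \<le> 2 * (1 / 2) ^ j"
    and app: "\<And>n j. j \<in> J \<Longrightarrow> j \<le> n \<Longrightarrow> norm ((T ^^ \<theta> n) (z j) - h (z j)) \<le> (2 + \<Gamma>) * (1 / 2) ^ n"
    and x: "x \<in> closure (cspan (z ` J))"
  shows "(\<lambda>n. (T ^^ \<theta> n) x) \<longlonglongrightarrow> h x"
proof -
  define K where "K = 54 + 14 * \<Gamma>"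
  define V where "V = cspan (z ` J)"
  have Tn: "clinear (T ^^ m)" for m using T(1) by (rule clinear_funpow)
  have sub: "csubspace (closure V)"
    unfolding V_def by (intro csubspace_closure complex_vector.subspace_span)
  have bounded: "norm ((T ^^ \<theta> n) v) \<le> K * norm v" if "v \<in> V" for n v
    unfolding K_def
    by (rule power_bound_on_span[OF Tn h _ e pert far app])
      (use \<mu> that in \<open>auto simp: norm_power power_le_one V_def\<close>)
  have bound: "norm ((T ^^ \<theta> n) v) \<le> K * norm v" if "v \<in> closure V" for n v
  proof -
    obtain w where w: "\<And>k. w k \<in> V" "w \<longlonglongrightarrow> v"
      using \<open>v \<in> closure V\<close> unfolding closure_sequential by blast
    have "bounded_linear (T ^^ \<theta> n)"
      using norm_funpow_le[of T L, OF T(2,3)] clinear_imp_linear[OF Tn]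
      by (intro bounded_linear_intro[of _ "L ^ \<theta> n"]) (auto simp: linear_add linear_cmul mult.commute)
    from bounded_linear.tendsto[OF this w(2)]
    have "(\<lambda>k. norm ((T ^^ \<theta> n) (w k))) \<longlonglongrightarrow> norm ((T ^^ \<theta> n) v)"
      by (rule tendsto_norm)
    moreover have "(\<lambda>k. K * norm (w k)) \<longlonglongrightarrow> K * norm v"
      by (intro tendsto_intros w)
    ultimately show ?thesis
      by (rule LIMSEQ_le) (use bounded w(1) in blast)
  qed
  have basis: "(\<lambda>n. (T ^^ \<theta> n) (z j)) \<longlonglongrightarrow> h (z j)" if "j \<in> J" for j
  proof -
    have "(\<lambda>n. (T ^^ \<theta> n) (z j) - h (z j)) \<longlonglongrightarrow> 0"
    proof (rule Lim_null_comparison)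
      show "\<forall>\<^sub>F n in sequentially. norm ((T ^^ \<theta> n) (z j) - h (z j)) \<le> (2 + \<Gamma>) * (1 / 2) ^ n"
        using app[OF that] by (intro eventually_sequentiallyI[of j])
      show "(\<lambda>n. (2 + \<Gamma>) * (1 / 2) ^ n) \<longlonglongrightarrow> 0"
        by (intro tendsto_mult_right_zero LIMSEQ_power_zero) simp
    qed
    then show ?thesis by (simp add: LIM_zero_iff)
  qed
  have lim: "(\<lambda>n. (T ^^ \<theta> n) v) \<longlonglongrightarrow> h v" if "v \<in> V" for v
    using that unfolding V_def
  proof (induction rule: complex_vector.span_induct_alt)
    case base
    then show ?case by (simp add: clinear_zero[OF Tn] clinear_zero[OF h(1)])
  next
    case (step c w v)
    then have "(\<lambda>n. c *\<^sub>C (T ^^ \<theta> n) w + (T ^^ \<theta> n) v) \<longlonglongrightarrow> c *\<^sub>C h w + h v"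
      using basis by (intro tendsto_add scaleC.tendsto tendsto_const) auto
    then show ?case
      by (simp add: clinear_add[OF Tn] clinear_scale[OF Tn] clinear_add[OF h(1)] clinear_scale[OF h(1)])
  qed
  show ?thesis
  proof (rule tendsto_on_closure[where S = "\<lambda>n. T ^^ \<theta> n" and K = K and V = V])
    show "norm (h v) \<le> K * norm v" for v
      using h(2)[of v] h(3) mult_right_mono[of \<Gamma> K "norm v"] by (simp add: K_def)
  qed (use clinear_diff[OF Tn] clinear_diff[OF h(1)] bound lim x sub in
      \<open>auto simp: V_def complex_vector.subspace_diff\<close>)
qed

lemma onorm_on_bound:
  assumes "\<And>x. norm (f x) \<le> K * norm x" "x \<in> E" "onorm_on E f \<le> C"
  shows "norm (f x) \<le> C * norm x"
proof (cases "x = 0")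
  case True
  then show ?thesis using assms(1)[of x] by simp
next
  case False
  have "bdd_above ((\<lambda>x. norm (f x) / norm x) ` E)"
  proof (rule bdd_aboveI2)
    fix y
    show "norm (f y) / norm y \<le> \<bar>K\<bar>"
    proof (cases "y = 0")
      case False
      have "norm (f y) \<le> \<bar>K\<bar> * norm y"
        using assms(1)[of y] by (meson abs_ge_self mult_right_mono norm_ge_zero order_trans)
      then show ?thesis using False by (simp add: field_simps)
    qed simp
  qed
  then have "norm (f x) / norm x \<le> onorm_on E f"
    unfolding onorm_on_def using assms(2) by (intro cSUP_upper)
  then have "norm (f x) / norm x \<le> C" using assms(3) by (rule order_trans)
  then show ?thesis using False by (simp add: pos_divide_le_eq)
qed

theorem corollary4p12:
  fixes T :: "'a::complex_banach \<Rightarrow> 'a"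
    and E :: "'a set"
    and \<psi> :: "nat \<Rightarrow> nat"
    and g :: "nat \<Rightarrow> 'a \<Rightarrow> 'a"
  assumes "separable_space (euclidean :: 'a topology)"
    and "infinite_dimensional (UNIV :: 'a set)"
    and "T \<in> cont_lin_ops"
    and "Omega_set T \<noteq> {}"
    and "inf_dim_closed_subspace E"
    and "pos_strict_seq \<psi>"
    and "bdd_above (range (\<lambda>n. onorm_on E (T ^^ \<psi> n)))"
    and "range g \<subseteq> Omega_set T"
    and "simultaneously_approximated (range g) T"
  shows "\<exists>\<theta> M. pos_strict_seq \<theta> \<and>
           (\<forall>i::nat. inf_dim_closed_subspace (M i) \<and>
              (\<forall>x\<in>M i. (\<lambda>n. (T ^^ \<theta> n) x) \<longlonglongrightarrow> g i x))"
proof -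
  have T: "clinear T" using assms(3) by (rule cont_lin_ops_clinear)
  obtain L where L: "L \<ge> 1" "\<And>x. norm (T x) \<le> L * norm x"
    using cont_lin_ops_bounded[OF assms(3)] by metis
  have gi: "g i \<in> cont_lin_ops" for i using assms(8) by (auto simp: Omega_set_def)
  have glin: "clinear (g i)" for i using gi by (rule cont_lin_ops_clinear)
  have "\<exists>\<Gamma>\<ge>1. \<forall>x. norm (g i x) \<le> \<Gamma> * norm x" for i
    using cont_lin_ops_bounded[OF gi] by metis
  then obtain \<Gamma> where \<Gamma>: "\<And>i. \<Gamma> i \<ge> (1::real)" "\<And>i x. norm (g i x) \<le> \<Gamma> i * norm x"
    by metis
  have \<Gamma>0: "\<Gamma> i \<ge> 0" for i using \<Gamma>(1)[of i] by simp
  obtain C where C: "\<And>n. onorm_on E (T ^^ \<psi> n) \<le> C"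
    using assms(7) by (auto simp: bdd_above_def)
  have E: "csubspace E" "infinite_dimensional E" and \<psi>: "strict_mono \<psi>"
    using assms(5,6) by (auto simp: inf_dim_closed_subspace_def pos_strict_seq_def)
  have "norm ((T ^^ \<psi> n) x) \<le> C * norm x" if "x \<in> E" for n x
    using L by (intro onorm_on_bound[OF norm_funpow_le that C]) auto
  then obtain \<mu> where \<mu>: "cmod \<mu> \<le> 1"
    "\<And>c. c > 0 \<Longrightarrow> \<exists>\<^sub>F y in cofin. norm (shift T \<mu> y) < c * norm y"
    using shift_not_bounded_below[OF T L(2,1) E \<psi>] by blast
  obtain e0 where e0: "basic e0" "\<And>n. norm (shift T \<mu> (e0 n)) \<le> (1 / 2) ^ n"
    using basic_sequence_exists[OF clinear_shift[OF T] \<mu>(2)] by blast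
  \<comment> \<open>Each value \<open>i\<close> is taken infinitely often by \<open>\<iota>\<close>; the vector with index \<open>j\<close> serves \<open>g (\<iota> j)\<close>.\<close>
  define \<iota> where "\<iota> j = fst (prod_decode j)" for j
  obtain \<theta> e z where \<theta>: "pos_strict_seq \<theta>" and e: "basic e"
    and pert: "\<forall>j. norm (z j - e j) \<le> (1 / 2) ^ j / 16"
    and far: "\<forall>n j. n < j \<longrightarrow> norm ((T ^^ \<theta> n) (z j) - \<mu> ^ \<theta> n *\<^sub>C e j) \<le> 2 * (1 / 2) ^ j"
    and app: "\<forall>n j. j \<le> n \<longrightarrow> norm ((T ^^ \<theta> n) (z j) - g (\<iota> j) (z j)) \<le> (2 + \<Gamma> (\<iota> j)) * (1 / 2) ^ n"
    using perturbed_basic_sequence[OF T L(2,1) assms(9), where f = "\<lambda>j. g (\<iota> j)"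
        and \<Gamma> = "\<lambda>j. \<Gamma> (\<iota> j)", OF rangeI glin \<Gamma>(2) \<Gamma>0 e0]
    by (elim exE conjE) (rule that)
  define J where "J i = {j. \<iota> j = i}" for i
  have J: "infinite (J i)" for i
  proof -
    have "range (\<lambda>k. prod_encode (i, k)) \<subseteq> J i" by (auto simp: J_def \<iota>_def)
    moreover have "infinite (range (\<lambda>k. prod_encode (i, k)))"
      by (rule range_inj_infinite) (simp add: inj_def)
    ultimately show ?thesis by (metis finite_subset)
  qed
  define M where "M i = closure (cspan (z ` J i))" for i
  have "inf_dim_closed_subspace (M i)" for i
    unfolding inf_dim_closed_subspace_def M_def
  proof (intro conjI)
    show "csubspace (closure (cspan (z ` J i)))"
      by (intro csubspace_closure complex_vector.subspace_span)
    show "infinite_dimensional (closure (cspan (z ` J i)))"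
      using complex_vector.span_superset[of "z ` J i"] closure_subset[of "cspan (z ` J i)"] pert
      by (intro infinite_dimensional_basic[OF e _ J]) auto
  qed simp
  moreover have "(\<lambda>n. (T ^^ \<theta> n) x) \<longlonglongrightarrow> g i x" if "x \<in> M i" for i x
    using that unfolding M_def
    by (rule convergence_on_closed_span[OF T L(2) _ glin \<Gamma>(2) \<Gamma>0 \<mu>(1) e, rotated -1])
      (use L(1) pert far app in \<open>auto simp: J_def\<close>)
  ultimately show ?thesis using \<theta> by blast
qed

end
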